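(* Let $n\geq 2$, let $A_1,\dots,A_n$ be algebras in a congruence permutable variety, and let $C\leq A_1\times\dots\times A_n$ be a subdirect product. For $1\leq i,j\leq n$, let $\lambda_{ij}:=\pi_j(\ker\pi_i\vee\ker\pi_j)$ and let $\gamma_j:=[\lambda_{1j},\dots,\lambda_{j-1,j},\lambda_{j+1,j},\dots,\lambda_{nj}]$ (the $(n-1)$-ary commutator), which are congruences on $A_j$. Then: (a) $C$ is a union of $\gamma_1\times\dots\times\gamma_n$-classes in $A_1\times\dots\times A_n$. (b) If $D\leq A_1\times\dots\times A_n$ is a subalgebra such that $\pi_{ij}(D)=\pi_{ij}(C)$ for all $1\leq i<j\leq n$ and $C/\gamma_1\times\dots\times\gamma_n\subseteq D/\gamma_1\times\dots\times\gamma_n$, then $C\leq D$. (c) $C$ is finitely generated if and only if $C/\gamma_1\times\dots\times\gamma_n$ and $\pi_{ij}(C)$ for all $1\leq i<j\leq n$ are finitely generated.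
   Context: A variety is a class of algebras of the same type defined by equations; it is congruence permutable if $\alpha\circ\beta=\beta\circ\alpha$ for all congruences $\alpha,\beta$ of every algebra in it. A subalgebra $C\leq A_1\times\dots\times A_n$ is a subdirect product if each coordinate projection $\pi_i$ maps $C$ onto $A_i$. $\pi_{ij}$ denotes the projection onto $A_i\times A_j$. In the definition of $\lambda_{ij}$, $\ker\pi_i$ is the kernel of $\pi_i$ restricted to $C$, a congruence of $C$; $\vee$ is the join in the congruence lattice of $C$; and $\pi_j(\theta)=\{(\pi_j(c),\pi_j(c')) : (c,c')\in\theta\}$. $\gamma_1\times\dots\times\gamma_n$ is the congruence on $A_1\times\dots\times A_n$ relating two tuples iff their $i$-th coordinates are $\gamma_i$-related for all $i$. For a subalgebra $S\leq A_1\times\dots\times A_n$, $S/\gamma_1\times\dots\times\gamma_n$ denotes the set of $\gamma_1\times\dots\times\gamma_n$-classes of elements of $S$, i.e. the image of $S$ in $A_1/\gamma_1\times\dots\times A_n/\gamma_n$. Higher commutators: let $\alpha_1,\dots,\alpha_k$ be congruences of an algebra $A$. For $1\leq i\leq k$ and $a,b\in A$ let $\mathrm{cube}^k_i(a,b)\colon\{0,1\}^k\to A$ be the function sending $x$ to $a$ if $x_i=0$ and to $b$ if $x_i=1$. Let $M_A(\alpha_1,\dots,\alpha_k)$ be the subalgebra of $A^{\{0,1\}^k}$ generated by all $\mathrm{cube}^k_i(a,b)$ with $1\leq i\leq k$, $(a,b)\in\alpha_i$. The $k$-ary commutator $[\alpha_1,\dots,\alpha_k]$ is the smallest congruence $\gamma$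 of $A$ such that every $f\in M_A(\alpha_1,\dots,\alpha_k)$ which satisfies $f(x_1,\dots,x_{k-1},0)\equiv_\gamma f(x_1,\dots,x_{k-1},1)$ for all $(x_1,\dots,x_{k-1})\in\{0,1\}^{k-1}\setminus\{(1,\dots,1)\}$ also satisfies $f(1,\dots,1,0)\equiv_\gamma f(1,\dots,1,1)$. In particular $[\alpha_1]=\alpha_1$ for $k=1$. *)

theory Defs
  imports "HOL.Hull" "HOL-Library.FuncSet"
begin

section \<open>Algebras, subalgebras and congruences\<close>

text \<open>
  A type of algebras is a set \<open>F\<close> of pairs of an operation symbol and an arity.  An algebra
  interprets a symbol as an operation on lists; only the values at lists over the carrier
  whose length is an arity of the symbol in \<open>F\<close> are ever used.
  Empty carriers are allowed (unless \<open>F\<close> contains a constant).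
\<close>

record ('f, 'a) alg =
  carrier :: "'a set"
  oper :: "'f \<Rightarrow> 'a list \<Rightarrow> 'a"

definition subalgebra :: "('f \<times> nat) set \<Rightarrow> ('f, 'a) alg \<Rightarrow> 'a set \<Rightarrow> bool" where
  "subalgebra F A S \<longleftrightarrow> S \<subseteq> carrier A \<and>
     (\<forall>f xs. (f, length xs) \<in> F \<longrightarrow> set xs \<subseteq> S \<longrightarrow> oper A f xs \<in> S)"

definition algebra :: "('f \<times> nat) set \<Rightarrow> ('f, 'a) alg \<Rightarrow> bool" where
  "algebra F A \<longleftrightarrow> subalgebra F A (carrier A)"

definition generated :: "('f \<times> nat) set \<Rightarrow> ('f, 'a) alg \<Rightarrow> 'a set \<Rightarrow> 'a set" where
  "generated F A X = subalgebra F A hull X"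

definition finitely_generated :: "('f \<times> nat) set \<Rightarrow> ('f, 'a) alg \<Rightarrow> 'a set \<Rightarrow> bool" where
  "finitely_generated F A S \<longleftrightarrow> (\<exists>X. finite X \<and> X \<subseteq> S \<and> generated F A X = S)"

definition congruence :: "('f \<times> nat) set \<Rightarrow> ('f, 'a) alg \<Rightarrow> 'a rel \<Rightarrow> bool" where
  "congruence F A \<theta> \<longleftrightarrow> equiv (carrier A) \<theta> \<and>
     (\<forall>f xs ys. (f, length xs) \<in> F \<longrightarrow> list_all2 (\<lambda>x y. (x, y) \<in> \<theta>) xs ys \<longrightarrow>
        (oper A f xs, oper A f ys) \<in> \<theta>)"

definition con_join :: "('f \<times> nat) set \<Rightarrow> ('f, 'a) alg \<Rightarrow> 'a rel \<Rightarrow> 'a rel \<Rightarrow> 'a rel" where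
  "con_join F A \<alpha> \<beta> = congruence F A hull (\<alpha> \<union> \<beta>)"

definition quot_alg :: "('f, 'a) alg \<Rightarrow> 'a rel \<Rightarrow> ('f, 'a set) alg" where
  "quot_alg A \<theta> = \<lparr>carrier = carrier A // \<theta>,
     oper = (\<lambda>f Xs. \<theta> `` {oper A f (map (\<lambda>X. SOME x. x \<in> X) Xs)})\<rparr>"

definition prod_alg :: "'i set \<Rightarrow> ('i \<Rightarrow> ('f, 'a) alg) \<Rightarrow> ('f, 'i \<Rightarrow> 'a) alg" where
  "prod_alg I A = \<lparr>carrier = (\<Pi>\<^sub>E i\<in>I. carrier (A i)),
     oper = (\<lambda>f xs. \<lambda>i\<in>I. oper (A i) f (map (\<lambda>x. x i) xs))\<rparr>"

definition prod_con :: "'i set \<Rightarrow> ('i \<Rightarrow> ('f, 'a) alg) \<Rightarrow> ('i \<Rightarrow> 'a rel) \<Rightarrow> ('i \<Rightarrow> 'a) rel" where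
  "prod_con I A \<gamma> = {(a, b). a \<in> carrier (prod_alg I A) \<and> b \<in> carrier (prod_alg I A) \<and>
     (\<forall>i\<in>I. (a i, b i) \<in> \<gamma> i)}"

definition subdirect :: "('f \<times> nat) set \<Rightarrow> 'i set \<Rightarrow> ('i \<Rightarrow> ('f, 'a) alg) \<Rightarrow> ('i \<Rightarrow> 'a) set \<Rightarrow> bool" where
  "subdirect F I A C \<longleftrightarrow> subalgebra F (prod_alg I A) C \<and>
     (\<forall>i\<in>I. (\<lambda>c. c i) ` C = carrier (A i))"

text \<open>
  The projection onto \<open>A i \<times> A j\<close>, \<open>i \<noteq> j\<close>, where the latter is \<open>prod_alg {i, j} A\<close>.
\<close>

definition pr2 :: "'i \<Rightarrow> 'i \<Rightarrow> ('i \<Rightarrow> 'a) \<Rightarrow> ('i \<Rightarrow> 'a)" where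
  "pr2 i j c = restrict c {i, j}"

section \<open>Varieties\<close>

datatype ('f, 'v) trm = Var 'v | App 'f "('f, 'v) trm list"

fun wf_trm :: "('f \<times> nat) set \<Rightarrow> ('f, 'v) trm \<Rightarrow> bool" where
  "wf_trm F (Var v) \<longleftrightarrow> True"
| "wf_trm F (App f ts) \<longleftrightarrow> (f, length ts) \<in> F \<and> (\<forall>t\<in>set ts. wf_trm F t)"

fun eval_trm :: "('f, 'a) alg \<Rightarrow> ('v \<Rightarrow> 'a) \<Rightarrow> ('f, 'v) trm \<Rightarrow> 'a" where
  "eval_trm A e (Var v) = e v"
| "eval_trm A e (App f ts) = oper A f (map (eval_trm A e) ts)"

type_synonym 'f equations = "(('f, nat) trm \<times> ('f, nat) trm) set"

definition wf_equations :: "('f \<times> nat) set \<Rightarrow> 'f equations \<Rightarrow> bool" where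
  "wf_equations F E \<longleftrightarrow> (\<forall>(s, t)\<in>E. wf_trm F s \<and> wf_trm F t)"

definition variety :: "('f \<times> nat) set \<Rightarrow> 'f equations \<Rightarrow> ('f, 'a) alg set" where
  "variety F E = {A. algebra F A \<and>
     (\<forall>(s, t)\<in>E. \<forall>e. range e \<subseteq> carrier A \<longrightarrow> eval_trm A e s = eval_trm A e t)}"

text \<open>
  A formula cannot quantify over the algebras on all types.  The type of sets of terms in
  countably many variables is used instead: every countably generated algebra is isomorphic
  to one whose elements are sets of terms, and permutability of two congruences only involves
  three elements at a time.  The lemma \<open>congruence_permutable_any_type\<close> below shows that
  congruences then permute in the algebras of the variety over any type.
\<close>

definition congruence_permutable :: "('f \<times> nat) set \<Rightarrow> 'f equations \<Rightarrow> bool" where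
  "congruence_permutable F E \<longleftrightarrow>
     (\<forall>B \<in> (variety F E :: ('f, ('f, nat) trm set) alg set). \<forall>\<alpha> \<beta>.
        congruence F B \<alpha> \<longrightarrow> congruence F B \<beta> \<longrightarrow> \<alpha> O \<beta> = \<beta> O \<alpha>)"

lemma eval_trm_closed:
  assumes "subalgebra F A S" "range e \<subseteq> S" "wf_trm F t"
  shows "eval_trm A e t \<in> S"
  using assms(3)
proof (induction t)
  case (Var v)
  then show ?case using assms(2) by auto
next
  case (App f ts)
  then have "set (map (eval_trm A e) ts) \<subseteq> S" "(f, length (map (eval_trm A e) ts)) \<in> F"
    by auto
  then show ?case using assms(1) unfolding subalgebra_def by (metis eval_trm.simps(2))
qed

lemma transport_variety:
  fixes B :: "('f, 'b) alg" and g :: "'b \<Rightarrow> 'c"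
  assumes B: "B \<in> variety F E" and wf: "wf_equations F E"
    and S: "subalgebra F B S" and g: "inj_on g S"
    and Q: "Q = \<lparr>carrier = g ` S, oper = (\<lambda>f xs. g (oper B f (map (inv_into S g) xs)))\<rparr>"
  shows "Q \<in> variety F E"
proof -
  have opS: "oper B f xs \<in> S" if "(f, length xs) \<in> F" "set xs \<subseteq> S" for f xs
    using S that unfolding subalgebra_def by blast
  have inv: "inv_into S g x \<in> S" "g (inv_into S g x) = x" if "x \<in> g ` S" for x
    using that by (auto simp: inv_into_into f_inv_into_f)
  have alg: "algebra F Q"
    unfolding algebra_def subalgebra_def Q using inv(1) by (auto simp: subset_iff intro!: imageI opS)
  have ev: "eval_trm Q e t = g (eval_trm B (inv_into S g \<circ> e) t)"
    if e: "range e \<subseteq> g ` S" and t: "wf_trm F t" for e and t :: "('f, nat) trm"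
    using t
  proof (induction t)
    case (Var v)
    then show ?case using inv(2) e by (simp add: range_subsetD)
  next
    case (App f ts)
    have rS: "range (inv_into S g \<circ> e) \<subseteq> S" using inv(1) e by (auto simp: image_subset_iff)
    define e' where "e' = inv_into S g \<circ> e"
    have "map (inv_into S g) (map (eval_trm Q e) ts) = map (eval_trm B e') ts"
      unfolding map_map
    proof (rule map_cong)
      fix t assume "t \<in> set ts"
      then show "(inv_into S g \<circ> eval_trm Q e) t = eval_trm B e' t"
        using App eval_trm_closed[OF S rS, of t] inv_into_f_f[OF g] unfolding e'_def[symmetric] by simp
    qed simp
    then show ?case unfolding e'_def[symmetric] by (simp add: Q del: map_map)
  qed
  have "eval_trm Q e s = eval_trm Q e t" if st: "(s, t) \<in> E" and e: "range e \<subseteq> carrier Q" for s t e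
  proof -
    have e': "range e \<subseteq> g ` S" using e by (simp add: Q)
    have "range (inv_into S g \<circ> e) \<subseteq> carrier B"
      using inv(1) e' S unfolding subalgebra_def by (auto simp: image_subset_iff)
    then have "eval_trm B (inv_into S g \<circ> e) s = eval_trm B (inv_into S g \<circ> e) t"
      using B st unfolding variety_def by auto
    then show ?thesis using ev[OF e'] wf st unfolding wf_equations_def by auto
  qed
  then show ?thesis using alg unfolding variety_def by auto
qed

lemma transport_congruence:
  assumes \<alpha>: "congruence F B \<alpha>" and S: "subalgebra F B S" and g: "inj_on g S"
    and Q: "Q = \<lparr>carrier = g ` S, oper = (\<lambda>f xs. g (oper B f (map (inv_into S g) xs)))\<rparr>"
  shows "congruence F Q {(g x, g y) | x y. x \<in> S \<and> y \<in> S \<and> (x, y) \<in> \<alpha>}" (is "congruence F Q ?r")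
proof -
  have SB: "S \<subseteq> carrier B" and opS: "\<And>f xs. (f, length xs) \<in> F \<Longrightarrow> set xs \<subseteq> S \<Longrightarrow> oper B f xs \<in> S"
    using S unfolding subalgebra_def by blast+
  have eq: "equiv (carrier B) \<alpha>" using \<alpha> unfolding congruence_def by blast
  have "equiv (g ` S) ?r"
  proof (rule equivI)
    show "refl_on (g ` S) ?r" using eq SB unfolding equiv_def refl_on_def by blast
    show "sym ?r" using eq unfolding equiv_def sym_def by blast
    show "trans ?r"
    proof (rule transI)
      fix x y z assume "(x, y) \<in> ?r" "(y, z) \<in> ?r"
      then obtain a b b' c where *: "x = g a" "y = g b" "y = g b'" "z = g c" "a \<in> S" "b \<in> S" "b' \<in> S"
        "c \<in> S" "(a, b) \<in> \<alpha>" "(b', c) \<in> \<alpha>" by blast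
      then have "b = b'" using g by (metis inj_onD)
      then have "(a, c) \<in> \<alpha>" using * eq unfolding equiv_def trans_def by blast
      then show "(x, z) \<in> ?r" using * by blast
    qed
  qed auto
  moreover have "(oper Q f xs, oper Q f ys) \<in> ?r"
    if f: "(f, length xs) \<in> F" and l: "list_all2 (\<lambda>x y. (x, y) \<in> ?r) xs ys" for f xs ys
  proof -
    let ?h = "inv_into S g"
    have h: "?h x \<in> S \<and> ?h y \<in> S \<and> (?h x, ?h y) \<in> \<alpha>" if "(x, y) \<in> ?r" for x y
      using that inv_into_f_f[OF g] by auto
    have len: "length ys = length xs" using list_all2_lengthD[OF l] by simp
    have nth: "?h (xs ! i) \<in> S \<and> ?h (ys ! i) \<in> S \<and> (?h (xs ! i), ?h (ys ! i)) \<in> \<alpha>"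
      if "i < length xs" for i
      by (rule h) (rule list_all2_nthD[OF l that])
    have "list_all2 (\<lambda>x y. (x, y) \<in> \<alpha>) (map ?h xs) (map ?h ys)"
      using nth len by (simp add: list_all2_conv_all_nth)
    then have \<alpha>': "(oper B f (map ?h xs), oper B f (map ?h ys)) \<in> \<alpha>"
      using \<alpha> f unfolding congruence_def by (metis length_map)
    have "set (map ?h xs) \<subseteq> S" "set (map ?h ys) \<subseteq> S"
      using nth len by (auto simp: in_set_conv_nth)
    then have "oper B f (map ?h xs) \<in> S" "oper B f (map ?h ys) \<in> S"
      using opS f len by (metis length_map)+
    with \<alpha>' show ?thesis by (auto simp: Q)
  qed
  ultimately show ?thesis unfolding congruence_def by (simp add: Q)
qed

theorem congruence_permutable_any_type:
  fixes B :: "('f, 'b) alg"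
  assumes wf: "wf_equations F E" and cp: "congruence_permutable F E" and B: "B \<in> variety F E"
    and \<alpha>: "congruence F B \<alpha>" and \<beta>: "congruence F B \<beta>"
  shows "\<alpha> O \<beta> = \<beta> O \<alpha>"
proof -
  have "\<alpha> O \<beta> \<subseteq> \<beta> O \<alpha>" if \<alpha>: "congruence F B \<alpha>" and \<beta>: "congruence F B \<beta>" for \<alpha> \<beta>
  proof
    fix p assume "p \<in> \<alpha> O \<beta>"
    then obtain a b c where p: "p = (a, c)" and ab: "(a, b) \<in> \<alpha>" and bc: "(b, c) \<in> \<beta>" by auto
    define e :: "nat \<Rightarrow> 'b" where "e = (\<lambda>i. if i = 0 then a else if i = 1 then b else c)"
    define S where "S = eval_trm B e ` Collect (wf_trm F)"
    define g where "g = (\<lambda>s. {t. wf_trm F t \<and> eval_trm B e t = s})"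
    have abc: "a \<in> carrier B" "b \<in> carrier B" "c \<in> carrier B"
      using ab bc \<alpha> \<beta> unfolding congruence_def equiv_def by auto
    have alg: "subalgebra F B (carrier B)" using B by (simp add: variety_def algebra_def)
    have rng: "range e \<subseteq> carrier B" using abc by (auto simp: e_def)
    have inS: "eval_trm B e t \<in> S" if "wf_trm F t" for t using that by (auto simp: S_def)
    have abcS: "a \<in> S" "b \<in> S" "c \<in> S"
      using inS[of "Var 0"] inS[of "Var 1"] inS[of "Var 2"] by (auto simp: e_def)
    have S: "subalgebra F B S"
      unfolding subalgebra_def
    proof (intro conjI allI impI)
      show "S \<subseteq> carrier B" using eval_trm_closed[OF alg rng] by (auto simp: S_def)
      fix f xs assume f: "(f, length xs) \<in> F" and xs: "set xs \<subseteq> S"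
      define k where "k = (\<lambda>x. SOME t. wf_trm F t \<and> eval_trm B e t = x)"
      have k: "wf_trm F (k x) \<and> eval_trm B e (k x) = x" if "x \<in> S" for x
        unfolding k_def by (rule someI_ex) (use that in \<open>auto simp: S_def\<close>)
      have "eval_trm B e (App f (map k xs)) = oper B f xs"
        using k xs by (auto simp: o_def intro!: arg_cong[of _ _ "oper B f"] map_idI)
      moreover have "wf_trm F (App f (map k xs))" using f k xs by auto
      ultimately show "oper B f xs \<in> S" using inS by metis
    qed
    have g: "inj_on g S"
    proof (rule inj_onI)
      fix x y assume "x \<in> S" "y \<in> S" "g x = g y"
      then show "x = y" unfolding S_def g_def by blast
    qed
    define Q where "Q = \<lparr>carrier = g ` S, oper = (\<lambda>f xs. g (oper B f (map (inv_into S g) xs)))\<rparr>"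
    let ?r = "\<lambda>\<alpha>. {(g x, g y) | x y. x \<in> S \<and> y \<in> S \<and> (x, y) \<in> \<alpha>}"
    have "?r \<alpha> O ?r \<beta> = ?r \<beta> O ?r \<alpha>"
      by (rule cp[unfolded congruence_permutable_def, rule_format,
            OF transport_variety[OF B wf S g Q_def] transport_congruence[OF \<alpha> S g Q_def]
              transport_congruence[OF \<beta> S g Q_def]])
    moreover have "(g a, g c) \<in> ?r \<alpha> O ?r \<beta>" using ab bc abcS by blast
    ultimately have "(g a, g c) \<in> ?r \<beta> O ?r \<alpha>" by simp
    then obtain y where "(g a, y) \<in> ?r \<beta>" "(y, g c) \<in> ?r \<alpha>" by (rule relcompEpair)
    then obtain a' d d' c' where *: "g a = g a'" "g d = g d'" "g c = g c'"
      "a' \<in> S" "d \<in> S" "d' \<in> S" "c' \<in> S" "(a', d) \<in> \<beta>" "(d', c') \<in> \<alpha>"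
      by (simp only: mem_Collect_eq prod.inject) metis
    then have "a = a'" "d = d'" "c = c'" using g abcS by (metis inj_onD)+
    then show "p \<in> \<beta> O \<alpha>" using * p by blast
  qed
  then show ?thesis using \<alpha> \<beta> by blast
qed

section \<open>Higher commutators\<close>

text \<open>
  The elements of \<open>{0,1}\<^sup>k\<close> are the Boolean lists of length \<open>k\<close>, and the coordinates
  \<open>1, \<dots>, k\<close> are numbered \<open>0, \<dots>, k - 1\<close>.
\<close>

definition cube :: "nat \<Rightarrow> nat \<Rightarrow> 'a \<Rightarrow> 'a \<Rightarrow> bool list \<Rightarrow> 'a" where
  "cube k i a b = (\<lambda>x\<in>{x. length x = k}. if x ! i then b else a)"

definition cube_alg :: "('f \<times> nat) set \<Rightarrow> ('f, 'a) alg \<Rightarrow> 'a rel list \<Rightarrow> (bool list \<Rightarrow> 'a) set" where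
  "cube_alg F A \<alpha>s = generated F (prod_alg {x. length x = length \<alpha>s} (\<lambda>_. A))
     {cube (length \<alpha>s) i a b | i a b. i < length \<alpha>s \<and> (a, b) \<in> \<alpha>s ! i}"

definition centralizes :: "('f \<times> nat) set \<Rightarrow> ('f, 'a) alg \<Rightarrow> 'a rel list \<Rightarrow> 'a rel \<Rightarrow> bool" where
  "centralizes F A \<alpha>s \<gamma> \<longleftrightarrow> (\<forall>f \<in> cube_alg F A \<alpha>s. let one = replicate (length \<alpha>s - 1) True in
     (\<forall>x. length x = length \<alpha>s - 1 \<longrightarrow> x \<noteq> one \<longrightarrow> (f (x @ [False]), f (x @ [True])) \<in> \<gamma>) \<longrightarrow>
     (f (one @ [False]), f (one @ [True])) \<in> \<gamma>)"

definition commutator :: "('f \<times> nat) set \<Rightarrow> ('f, 'a) alg \<Rightarrow> 'a rel list \<Rightarrow> 'a rel" where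
  "commutator F A \<alpha>s = (LEAST \<gamma>. congruence F A \<gamma> \<and> centralizes F A \<alpha>s \<gamma>)"

section \<open>The congruences attached to a subdirect product\<close>

definition ker_proj :: "('i \<Rightarrow> 'a) set \<Rightarrow> 'i \<Rightarrow> ('i \<Rightarrow> 'a) rel" where
  "ker_proj C i = {(c, d). c \<in> C \<and> d \<in> C \<and> c i = d i}"

definition lam :: "('f \<times> nat) set \<Rightarrow> nat \<Rightarrow> (nat \<Rightarrow> ('f, 'a) alg) \<Rightarrow> (nat \<Rightarrow> 'a) set \<Rightarrow> nat \<Rightarrow> nat \<Rightarrow> 'a rel" where
  "lam F n A C i j = (\<lambda>(c, d). (c j, d j)) `
     con_join F (prod_alg {1..n} A \<lparr>carrier := C\<rparr>) (ker_proj C i) (ker_proj C j)"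

definition gam :: "('f \<times> nat) set \<Rightarrow> nat \<Rightarrow> (nat \<Rightarrow> ('f, 'a) alg) \<Rightarrow> (nat \<Rightarrow> 'a) set \<Rightarrow> nat \<Rightarrow> 'a rel" where
  "gam F n A C j = commutator F (A j) (map (\<lambda>i. lam F n A C i j) ([1..<j] @ [Suc j..<Suc n]))"

section \<open>Existence of the smallest congruences\<close>

lemma congruence_all:
  assumes "algebra F A"
  shows "congruence F A (carrier A \<times> carrier A)"
proof -
  have "set xs \<subseteq> carrier A \<and> set ys \<subseteq> carrier A \<and> length xs = length ys"
    if "list_all2 (\<lambda>x y. (x, y) \<in> carrier A \<times> carrier A) xs ys" for xs ys
    using that by (induction rule: list_all2_induct) auto
  then show ?thesis
    using assms unfolding congruence_def algebra_def subalgebra_def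
    by (auto simp: equiv_def refl_on_def sym_def trans_def)
qed

lemma congruence_Inter:
  assumes "T \<noteq> {}" "\<And>\<theta>. \<theta> \<in> T \<Longrightarrow> congruence F A \<theta>"
  shows "congruence F A (\<Inter>T)"
  unfolding congruence_def
proof (intro conjI allI impI)
  have "equiv (carrier A) \<theta>" if "\<theta> \<in> T" for \<theta> using assms that unfolding congruence_def by blast
  then have *: "\<theta> \<subseteq> carrier A \<times> carrier A" "refl_on (carrier A) \<theta>" "sym \<theta>" "trans \<theta>"
    if "\<theta> \<in> T" for \<theta> using that unfolding equiv_def by blast+
  show "equiv (carrier A) (\<Inter>T)"
  proof (rule equivI)
    show "\<Inter>T \<subseteq> carrier A \<times> carrier A" using assms(1) *(1) by blast
    show "refl_on (carrier A) (\<Inter>T)" using *(2) by (simp add: refl_on_def)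
    show "sym (\<Inter>T)" using *(3) unfolding sym_def by blast
    show "trans (\<Inter>T)" using *(4) unfolding trans_def by blast
  qed
  fix f xs ys assume f: "(f, length xs) \<in> F" and l: "list_all2 (\<lambda>x y. (x, y) \<in> \<Inter>T) xs ys"
  show "(oper A f xs, oper A f ys) \<in> \<Inter>T"
  proof
    fix \<theta> assume "\<theta> \<in> T"
    moreover have "list_all2 (\<lambda>x y. (x, y) \<in> \<theta>) xs ys"
      by (rule list_all2_mono[OF l]) (use \<open>\<theta> \<in> T\<close> in blast)
    ultimately show "(oper A f xs, oper A f ys) \<in> \<theta>" using assms(2) f unfolding congruence_def by blast
  qed
qed

lemma con_join_least:
  assumes A: "algebra F A" and \<alpha>: "congruence F A \<alpha>" and \<beta>: "congruence F A \<beta>"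
  shows "congruence F A (con_join F A \<alpha> \<beta>)" "\<alpha> \<union> \<beta> \<subseteq> con_join F A \<alpha> \<beta>"
    "\<And>\<theta>. congruence F A \<theta> \<Longrightarrow> \<alpha> \<union> \<beta> \<subseteq> \<theta> \<Longrightarrow> con_join F A \<alpha> \<beta> \<subseteq> \<theta>"
proof -
  have "carrier A \<times> carrier A \<in> {\<theta>. congruence F A \<theta> \<and> \<alpha> \<union> \<beta> \<subseteq> \<theta>}"
    using congruence_all[OF A] \<alpha> \<beta> unfolding congruence_def equiv_def by auto
  then show "congruence F A (con_join F A \<alpha> \<beta>)"
    unfolding con_join_def hull_def by (intro congruence_Inter) auto
  show "\<alpha> \<union> \<beta> \<subseteq> con_join F A \<alpha> \<beta>"
    unfolding con_join_def by (rule hull_subset)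
  show "con_join F A \<alpha> \<beta> \<subseteq> \<theta>" if "congruence F A \<theta>" "\<alpha> \<union> \<beta> \<subseteq> \<theta>" for \<theta>
    unfolding con_join_def by (rule hull_minimal) (use that in blast)+
qed

lemma commutator_least:
  assumes A: "algebra F A" and \<alpha>s: "\<And>\<alpha>. \<alpha> \<in> set \<alpha>s \<Longrightarrow> congruence F A \<alpha>" "\<alpha>s \<noteq> []"
  shows "congruence F A (commutator F A \<alpha>s)" "centralizes F A \<alpha>s (commutator F A \<alpha>s)"
    "\<And>\<gamma>. congruence F A \<gamma> \<Longrightarrow> centralizes F A \<alpha>s \<gamma> \<Longrightarrow> commutator F A \<alpha>s \<subseteq> \<gamma>"
proof -
  let ?I = "{x :: bool list. length x = length \<alpha>s}"
  let ?P = "prod_alg ?I (\<lambda>_. A)"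
  define G where "G = {\<gamma>. congruence F A \<gamma> \<and> centralizes F A \<alpha>s \<gamma>}"
  have mem: "a \<in> carrier A \<and> b \<in> carrier A" if "i < length \<alpha>s" "(a, b) \<in> \<alpha>s ! i" for i a b
    using \<alpha>s(1)[OF nth_mem[OF that(1)]] that(2) unfolding congruence_def equiv_def by auto
  have "oper A f (map (\<lambda>x. x i) xs) \<in> carrier A"
    if "(f, length xs) \<in> F" "set xs \<subseteq> carrier ?P" "i \<in> ?I" for f xs i
  proof -
    have "set (map (\<lambda>x. x i) xs) \<subseteq> carrier A" using that(2,3) by (auto simp: prod_alg_def)
    then show ?thesis using A that(1) unfolding algebra_def subalgebra_def by (metis length_map)
  qed
  then have "subalgebra F ?P (carrier ?P)"
    by (simp add: subalgebra_def prod_alg_def)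
  then have M: "cube_alg F A \<alpha>s \<subseteq> carrier ?P"
    unfolding cube_alg_def generated_def
    by (intro hull_minimal) (auto simp: prod_alg_def cube_def dest: mem split: if_splits)
  have "f x \<in> carrier A" if "f \<in> cube_alg F A \<alpha>s" "length x = length \<alpha>s" for f x
    using subsetD[OF M that(1)] that(2) by (auto simp: prod_alg_def)
  then have "centralizes F A \<alpha>s (carrier A \<times> carrier A)"
    using \<alpha>s(2) by (auto simp: centralizes_def Let_def)
  then have ne: "G \<noteq> {}" using congruence_all[OF A] by (auto simp: G_def)
  then have c1: "congruence F A (\<Inter>G)" by (intro congruence_Inter) (auto simp: G_def)
  have c2: "centralizes F A \<alpha>s (\<Inter>G)"
    unfolding centralizes_def Let_def
  proof (intro ballI impI InterI)
    fix f \<gamma> assume "f \<in> cube_alg F A \<alpha>s" "\<gamma> \<in> G" and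
      "\<forall>x. length x = length \<alpha>s - 1 \<longrightarrow> x \<noteq> replicate (length \<alpha>s - 1) True \<longrightarrow>
         (f (x @ [False]), f (x @ [True])) \<in> \<Inter>G"
    then show "(f (replicate (length \<alpha>s - 1) True @ [False]), f (replicate (length \<alpha>s - 1) True @ [True])) \<in> \<gamma>"
      by (auto simp: G_def centralizes_def Let_def)
  qed
  have "commutator F A \<alpha>s = \<Inter>G"
    unfolding commutator_def by (rule Least_equality) (use c1 c2 in \<open>auto simp: G_def\<close>)
  then show "congruence F A (commutator F A \<alpha>s)" "centralizes F A \<alpha>s (commutator F A \<alpha>s)"
    "\<And>\<gamma>. congruence F A \<gamma> \<Longrightarrow> centralizes F A \<alpha>s \<gamma> \<Longrightarrow> commutator F A \<alpha>s \<subseteq> \<gamma>"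
    using c1 c2 by (auto simp: G_def)
qed

end

theory Submission
  imports Defs
begin

text \<open>
  Congruence permutability provides a Mal'cev operation \<open>m\<close>, with \<open>m(x,x,y) = y\<close> and
  \<open>m(x,y,y) = x\<close>, under which all subalgebras are closed.  It has three consequences for a
  subdirect product \<open>C\<close>.

  Firstly, for a set \<open>J\<close> of coordinates, the pairs \<open>(c\<^sub>j, d\<^sub>j)\<close> with \<open>c, d \<in> C\<close> equal on \<open>J\<close> form
  a congruence \<open>agree J j\<close> of \<open>A\<^sub>j\<close> (\<open>congruence_agree\<close>), and \<open>\<lambda>\<^sub>i\<^sub>j\<close> is \<open>agree {i} j\<close>
  (\<open>proj_con_join\<close>).

  Secondly, put \<open>\<eta>\<^sub>j = agree (I - {j}) j\<close>.  A coordinate of an element of \<open>C\<close> may be moved along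
  \<open>\<eta>\<^sub>j\<close> without leaving \<open>C\<close>: if \<open>u, v \<in> C\<close> differ only at \<open>j\<close> and \<open>c\<^sub>j = u\<^sub>j\<close>, then
  \<open>m(c, u, v)\<close> is \<open>c\<close> with its \<open>j\<close>-th coordinate replaced by \<open>v\<^sub>j\<close> (\<open>replace_coordinate\<close>).

  Thirdly, \<open>\<eta>\<^sub>j\<close> centralizes the congruences \<open>\<lambda>\<^sub>i\<^sub>j\<close>, \<open>i \<noteq> j\<close> (\<open>agree_centralizes\<close>), so that
  \<open>\<gamma>\<^sub>j \<subseteq> \<eta>\<^sub>j\<close>.  Indeed a generator of \<open>M(\<dots>, \<lambda>\<^sub>i\<^sub>j, \<dots>)\<close> is the \<open>j\<close>-th coordinate of a cube of
  elements of \<open>C\<close> whose \<open>i\<close>-th coordinate does not vary in direction \<open>i\<close>, hence so is every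
  element \<open>f\<close> (\<open>cube_lift\<close>).  Suppose that \<open>f(x,0)\<close> and \<open>f(x,1)\<close> are \<open>\<eta>\<^sub>j\<close>-related for
  \<open>x \<noteq> (1,\<dots>,1)\<close>.  By the second point these values can be made equal.  Now \<open>m\<close> computes a last
  corner of a cube from the others (\<open>fill\<close>): it returns the actual corner \<open>g(1,\<dots>,1)\<close> if \<open>g\<close> is
  constant in some direction, and \<open>g(1,\<dots>,1,0)\<close> if \<open>g(x,0) = g(x,1)\<close> for all \<open>x \<noteq> (1,\<dots>,1)\<close>.
  The computed corner therefore agrees with the actual corner at all \<open>i \<noteq> j\<close>, while their \<open>j\<close>-th
  coordinates are \<open>f(1,\<dots>,1,0)\<close> and \<open>f(1,\<dots>,1,1)\<close>, which are thus \<open>\<eta>\<^sub>j\<close>-related.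

  Part (a) follows by moving the coordinates one after the other.  For (b), \<open>\<lambda>\<^sub>i\<^sub>j = agree {i} j\<close>
  is determined by the projection to the coordinates \<open>i, j\<close>, so \<open>D\<close> has the same \<open>\<gamma>\<close>'s as \<open>C\<close>,
  and (a) for \<open>D\<close> gives \<open>C \<subseteq> D\<close>.  For (c), choose a finite subset of \<open>C\<close> whose images
  generate all the given homomorphic images of \<open>C\<close>; the subalgebra generated by it is all of
  \<open>C\<close> by (b).
\<close>

section \<open>Generated subalgebras, products and quotients\<close>

lemma subalgebra_oper:
  "subalgebra F A S \<Longrightarrow> (f, length xs) \<in> F \<Longrightarrow> set xs \<subseteq> S \<Longrightarrow> oper A f xs \<in> S"
  unfolding subalgebra_def by blast

lemma subalgebra_generated:
  assumes "algebra F A" "X \<subseteq> carrier A"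
  shows "subalgebra F A (generated F A X)"
  unfolding subalgebra_def
proof (intro conjI allI impI)
  show "generated F A X \<subseteq> carrier A"
    using assms unfolding generated_def algebra_def by (intro hull_minimal)
  fix f xs assume f: "(f, length xs) \<in> F" and xs: "set xs \<subseteq> generated F A X"
  show "oper A f xs \<in> generated F A X"
    unfolding generated_def hull_def
  proof
    fix S assume "S \<in> {S. subalgebra F A S \<and> X \<subseteq> S}"
    then have S: "subalgebra F A S" "X \<subseteq> S" by auto
    then have "set xs \<subseteq> S" using xs hull_minimal[of X S "subalgebra F A"] unfolding generated_def by auto
    then show "oper A f xs \<in> S" using S f unfolding subalgebra_def by blast
  qed
qed

lemma generated_superset: "X \<subseteq> generated F A X"
  unfolding generated_def by (rule hull_subset)

lemma generated_least: "X \<subseteq> S \<Longrightarrow> subalgebra F A S \<Longrightarrow> generated F A X \<subseteq> S"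
  unfolding generated_def by (rule hull_minimal)

definition hom :: "('f \<times> nat) set \<Rightarrow> ('f, 'a) alg \<Rightarrow> ('f, 'b) alg \<Rightarrow> ('a \<Rightarrow> 'b) \<Rightarrow> bool" where
  "hom F P Q h \<longleftrightarrow> h ` carrier P \<subseteq> carrier Q \<and>
     (\<forall>f xs. (f, length xs) \<in> F \<longrightarrow> set xs \<subseteq> carrier P \<longrightarrow> h (oper P f xs) = oper Q f (map h xs))"

lemma hom_image_generated:
  assumes P: "algebra F P" and Q: "algebra F Q" and h: "hom F P Q h" and X: "X \<subseteq> carrier P"
  shows "h ` generated F P X = generated F Q (h ` X)"
proof
  have hX: "h ` X \<subseteq> carrier Q" using h X unfolding hom_def by blast
  note GP = subalgebra_generated[OF P X] and GQ = subalgebra_generated[OF Q hX]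
  have "subalgebra F P {x \<in> carrier P. h x \<in> generated F Q (h ` X)}"
    unfolding subalgebra_def
  proof (intro conjI allI impI)
    fix f xs assume f: "(f, length xs) \<in> F"
      and xs: "set xs \<subseteq> {x \<in> carrier P. h x \<in> generated F Q (h ` X)}"
    have "set (map h xs) \<subseteq> generated F Q (h ` X)" using xs by auto
    then have "oper Q f (map h xs) \<in> generated F Q (h ` X)"
      using GQ f unfolding subalgebra_def by (metis length_map)
    moreover have "set xs \<subseteq> carrier P" using xs by auto
    ultimately show "oper P f xs \<in> {x \<in> carrier P. h x \<in> generated F Q (h ` X)}"
      using P f h unfolding algebra_def subalgebra_def hom_def by auto
  qed auto
  moreover have "X \<subseteq> {x \<in> carrier P. h x \<in> generated F Q (h ` X)}"
    using X generated_superset[of "h ` X" F Q] by auto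
  ultimately show "h ` generated F P X \<subseteq> generated F Q (h ` X)"
    using generated_least by blast
  have "subalgebra F Q (h ` generated F P X)"
    unfolding subalgebra_def
  proof (intro conjI allI impI)
    show "h ` generated F P X \<subseteq> carrier Q" using GP h unfolding subalgebra_def hom_def by blast
    fix f ys assume f: "(f, length ys) \<in> F" and ys: "set ys \<subseteq> h ` generated F P X"
    then have "ys \<in> map h ` lists (generated F P X)" by (simp add: in_lists_conv_set subset_iff flip: lists_image)
    then obtain xs where xs: "set xs \<subseteq> generated F P X" "ys = map h xs" by auto
    then have "oper P f xs \<in> generated F P X" "set xs \<subseteq> carrier P"
      using GP f unfolding subalgebra_def by auto
    then show "oper Q f ys \<in> h ` generated F P X"
      using h f xs unfolding hom_def by (metis image_eqI length_map)
  qed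
  then show "generated F Q (h ` X) \<subseteq> h ` generated F P X"
    by (rule generated_least[OF image_mono[OF generated_superset]])
qed

lemma finitely_generated_hom_image:
  assumes "algebra F P" "algebra F Q" "hom F P Q h" "S \<subseteq> carrier P" "finitely_generated F P S"
  shows "finitely_generated F Q (h ` S)"
proof -
  obtain X where X: "finite X" "X \<subseteq> S" "generated F P X = S"
    using assms(5) unfolding finitely_generated_def by blast
  then have "generated F Q (h ` X) = h ` S" using hom_image_generated[OF assms(1-3), of X] assms(4) by auto
  then show ?thesis using X unfolding finitely_generated_def by (metis finite_imageI image_mono)
qed

lemma algebra_prod_alg:
  assumes "\<And>i. i \<in> I \<Longrightarrow> algebra F (A i)"
  shows "algebra F (prod_alg I A)"
proof -
  have "oper (A i) f (map (\<lambda>x. x i) xs) \<in> carrier (A i)"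
    if "(f, length xs) \<in> F" "set xs \<subseteq> carrier (prod_alg I A)" "i \<in> I" for f xs i
  proof -
    have "set (map (\<lambda>x. x i) xs) \<subseteq> carrier (A i)" using that(2,3) by (auto simp: prod_alg_def)
    then show ?thesis using assms[OF that(3)] that(1) unfolding algebra_def subalgebra_def by (metis length_map)
  qed
  then show ?thesis by (simp add: algebra_def subalgebra_def prod_alg_def)
qed

lemma oper_prod_alg: "i \<in> I \<Longrightarrow> oper (prod_alg I A) f xs i = oper (A i) f (map (\<lambda>x. x i) xs)"
  by (simp add: prod_alg_def)

lemma congruence_prod_con:
  assumes "\<And>i. i \<in> I \<Longrightarrow> algebra F (A i)" "\<And>i. i \<in> I \<Longrightarrow> congruence F (A i) (\<gamma> i)"
  shows "congruence F (prod_alg I A) (prod_con I A \<gamma>)"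
  unfolding congruence_def
proof (intro conjI allI impI)
  have eq: "equiv (carrier (A i)) (\<gamma> i)" if "i \<in> I" for i using assms(2)[OF that] unfolding congruence_def by blast
  show "equiv (carrier (prod_alg I A)) (prod_con I A \<gamma>)"
  proof (rule equivI)
    show "refl_on (carrier (prod_alg I A)) (prod_con I A \<gamma>)"
    proof (rule refl_onI)
      fix x assume x: "x \<in> carrier (prod_alg I A)"
      then have "x i \<in> carrier (A i)" if "i \<in> I" for i using that by (auto simp: prod_alg_def)
      then have "(x i, x i) \<in> \<gamma> i" if "i \<in> I" for i
        using eq[OF that] that unfolding equiv_def refl_on_def by blast
      then show "(x, x) \<in> prod_con I A \<gamma>" using x by (simp add: prod_con_def)
    qed
    show "sym (prod_con I A \<gamma>)"
      using eq unfolding equiv_def sym_def prod_con_def by blast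
    show "trans (prod_con I A \<gamma>)"
    proof (rule transI)
      fix x y z assume *: "(x, y) \<in> prod_con I A \<gamma>" "(y, z) \<in> prod_con I A \<gamma>"
      then have "(x i, z i) \<in> \<gamma> i" if "i \<in> I" for i
        using eq[OF that] that unfolding equiv_def trans_def prod_con_def by blast
      then show "(x, z) \<in> prod_con I A \<gamma>" using * by (simp add: prod_con_def)
    qed
  qed (auto simp: prod_con_def)
  fix f xs ys assume f: "(f, length xs) \<in> F" and l: "list_all2 (\<lambda>x y. (x, y) \<in> prod_con I A \<gamma>) xs ys"
  have len: "length ys = length xs" using list_all2_lengthD[OF l] by simp
  have nth: "(xs ! k, ys ! k) \<in> prod_con I A \<gamma>" if "k < length xs" for k
    using list_all2_nthD[OF l that] .
  then have "set xs \<subseteq> carrier (prod_alg I A)" "set ys \<subseteq> carrier (prod_alg I A)"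
    using len by (auto simp: in_set_conv_nth prod_con_def)
  then have "oper (prod_alg I A) f xs \<in> carrier (prod_alg I A)" "oper (prod_alg I A) f ys \<in> carrier (prod_alg I A)"
    using algebra_prod_alg[of I F A] assms(1) f len unfolding algebra_def subalgebra_def by auto
  moreover have "(oper (A i) f (map (\<lambda>x. x i) xs), oper (A i) f (map (\<lambda>x. x i) ys)) \<in> \<gamma> i" if "i \<in> I" for i
  proof -
    have "list_all2 (\<lambda>x y. (x, y) \<in> \<gamma> i) (map (\<lambda>x. x i) xs) (map (\<lambda>x. x i) ys)"
      using nth len that by (auto simp: list_all2_conv_all_nth prod_con_def)
    then show ?thesis using assms(2)[OF that] f unfolding congruence_def by (metis length_map)
  qed
  ultimately show "(oper (prod_alg I A) f xs, oper (prod_alg I A) f ys) \<in> prod_con I A \<gamma>"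
    by (simp add: prod_con_def oper_prod_alg)
qed

lemma hom_quotient:
  assumes \<theta>: "congruence F P \<theta>"
  shows "hom F P (quot_alg P \<theta>) (\<lambda>c. \<theta> `` {c})"
  unfolding hom_def
proof (intro conjI allI impI)
  have eq: "equiv (carrier P) \<theta>" using \<theta> unfolding congruence_def by blast
  show "(\<lambda>c. \<theta> `` {c}) ` carrier P \<subseteq> carrier (quot_alg P \<theta>)"
    by (auto simp: quot_alg_def quotient_def)
  fix f xs assume f: "(f, length xs) \<in> F" and xs: "set xs \<subseteq> carrier P"
  have rep: "(c, SOME x. x \<in> \<theta> `` {c}) \<in> \<theta>" if "c \<in> carrier P" for c
  proof -
    have "c \<in> \<theta> `` {c}" using eq that by (rule equiv_class_self)
    then show ?thesis by (metis Image_singleton_iff someI)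
  qed
  have "list_all2 (\<lambda>x y. (x, y) \<in> \<theta>) xs (map (\<lambda>X. SOME x. x \<in> X) (map (\<lambda>c. \<theta> `` {c}) xs))"
    using rep xs by (simp add: list_all2_conv_all_nth subset_iff)
  then have "(oper P f xs, oper P f (map (\<lambda>X. SOME x. x \<in> X) (map (\<lambda>c. \<theta> `` {c}) xs))) \<in> \<theta>"
    using \<theta> f unfolding congruence_def by blast
  then show "\<theta> `` {oper P f xs} = oper (quot_alg P \<theta>) f (map (\<lambda>c. \<theta> `` {c}) xs)"
    using equiv_class_eq[OF eq] unfolding quot_alg_def by auto
qed

lemma algebra_hom_image:
  assumes P: "algebra F P" and h: "hom F P Q h" and onto: "h ` carrier P = carrier Q"
  shows "algebra F Q"
  unfolding algebra_def subalgebra_def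
proof (intro conjI allI impI)
  fix f ys assume f: "(f, length ys) \<in> F" and ys: "set ys \<subseteq> carrier Q"
  then have "ys \<in> map h ` lists (carrier P)" by (simp add: onto in_lists_conv_set subset_iff flip: lists_image)
  then obtain xs where xs: "set xs \<subseteq> carrier P" "ys = map h xs" by auto
  then have "h (oper P f xs) = oper Q f ys" "oper P f xs \<in> carrier P"
    using h P f unfolding hom_def algebra_def subalgebra_def by auto
  then show "oper Q f ys \<in> carrier Q" using onto by (metis image_eqI)
qed simp

lemma algebra_quot_alg:
  assumes "algebra F P" "congruence F P \<theta>"
  shows "algebra F (quot_alg P \<theta>)"
  by (rule algebra_hom_image[OF assms(1) hom_quotient[OF assms(2)]])
    (auto simp: quot_alg_def quotient_def)

lemma hom_pr2:
  assumes "i \<in> I" "j \<in> I"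
  shows "hom F (prod_alg I A) (prod_alg {i, j} A) (pr2 i j)"
  unfolding hom_def
proof (intro conjI allI impI)
  show "pr2 i j ` carrier (prod_alg I A) \<subseteq> carrier (prod_alg {i, j} A)"
  proof (intro subsetI, elim imageE)
    fix c d assume "c \<in> carrier (prod_alg I A)" "d = pr2 i j c"
    then show "d \<in> carrier (prod_alg {i, j} A)"
      using assms by (simp add: pr2_def prod_alg_def restrict_PiE_iff) (metis PiE_mem)
  qed
  fix f xs
  show "pr2 i j (oper (prod_alg I A) f xs) = oper (prod_alg {i, j} A) f (map (pr2 i j) xs)"
    using assms by (auto simp: pr2_def prod_alg_def fun_eq_iff o_def)
qed

section \<open>Mal'cev operations\<close>

lemma eval_trm_prod_alg:
  assumes A: "\<And>i. i \<in> I \<Longrightarrow> algebra F (A i)"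
    and e: "range e \<subseteq> carrier (prod_alg I A)" and t: "wf_trm F t"
  shows "eval_trm (prod_alg I A) e t = (\<lambda>i\<in>I. eval_trm (A i) (\<lambda>v. e v i) t)"
  using t
proof (induction t)
  case (Var v)
  have "e v \<in> extensional I" using e by (auto simp: prod_alg_def PiE_def)
  then show ?case by (simp add: fun_eq_iff extensional_def)
next
  case (App f ts)
  have "map (\<lambda>x. x i) (map (eval_trm (prod_alg I A) e) ts) = map (eval_trm (A i) (\<lambda>v. e v i)) ts"
    if "i \<in> I" for i
    using App that by (simp add: o_def)
  then show ?case
    by (simp add: oper_prod_alg fun_eq_iff del: map_map) (simp add: prod_alg_def)
qed

lemma variety_prod_alg:
  assumes wf: "wf_equations F E" and A: "\<And>i. i \<in> I \<Longrightarrow> A i \<in> variety F E"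
  shows "prod_alg I A \<in> variety F E"
proof -
  have alg: "algebra F (A i)" if "i \<in> I" for i using A[OF that] by (simp add: variety_def)
  have "eval_trm (prod_alg I A) e s = eval_trm (prod_alg I A) e t"
    if st: "(s, t) \<in> E" and e: "range e \<subseteq> carrier (prod_alg I A)" for s t e
  proof -
    have "eval_trm (A i) (\<lambda>v. e v i) s = eval_trm (A i) (\<lambda>v. e v i) t" if i: "i \<in> I" for i
    proof -
      have "range (\<lambda>v. e v i) \<subseteq> carrier (A i)" using e i by (auto simp: prod_alg_def)
      then show ?thesis using A[OF i] st unfolding variety_def by auto
    qed
    moreover have "wf_trm F s" "wf_trm F t" using wf st by (auto simp: wf_equations_def)
    ultimately show ?thesis using eval_trm_prod_alg[OF alg e] by (simp add: fun_eq_iff)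
  qed
  then show ?thesis using algebra_prod_alg[OF alg] by (auto simp: variety_def)
qed

lemma eval_trm_carrier_update: "eval_trm (B\<lparr>carrier := T\<rparr>) e t = eval_trm B e t"
proof (induction t)
  case (App f ts)
  then have "map (eval_trm (B\<lparr>carrier := T\<rparr>) e) ts = map (eval_trm B e) ts" by simp
  then show ?case by (simp only: eval_trm.simps) simp
qed simp

lemma variety_subalgebra:
  assumes "B \<in> variety F E" "subalgebra F B T"
  shows "B\<lparr>carrier := T\<rparr> \<in> variety F E"
  using assms unfolding variety_def algebra_def subalgebra_def by (auto simp: eval_trm_carrier_update)

text \<open>
  The ternary term operations, simultaneous for all \<open>A i\<close>, are the elements of the subalgebra \<open>T\<close>
  generated by the three projections in a power of the factors: its coordinates are the indices
  with triples of elements.  Two elements of \<open>T\<close> are related by \<open>\<theta> K\<close> if they agree on \<open>K\<close>.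
  As the first projection agrees with the second on the triples \<open>(x, x, z)\<close>, and the second with
  the third on the triples \<open>(x, y, y)\<close>, permutability yields a Mal'cev operation in \<open>T\<close>.
\<close>

lemma malcev_operations:
  fixes A :: "'i \<Rightarrow> ('f, 'a) alg"
  assumes wf: "wf_equations F E" and cp: "congruence_permutable F E"
    and A: "\<And>i. i \<in> I \<Longrightarrow> A i \<in> variety F E"
  obtains m :: "'i \<Rightarrow> 'a \<Rightarrow> 'a \<Rightarrow> 'a \<Rightarrow> 'a" where "\<And>i x y. m i x x y = y" "\<And>i x y. m i x y y = x"
    "\<And>S u v w. subalgebra F (prod_alg I A) S \<Longrightarrow> u \<in> S \<Longrightarrow> v \<in> S \<Longrightarrow> w \<in> S \<Longrightarrow>
       (\<lambda>i\<in>I. m i (u i) (v i) (w i)) \<in> S"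
proof -
  define J where "J = {(i, x, y, z). i \<in> I \<and> x \<in> carrier (A i) \<and> y \<in> carrier (A i) \<and> z \<in> carrier (A i)}"
  define B where "B = prod_alg J (\<lambda>(i, _). A i)"
  define p q r where "p = (\<lambda>(i, x, y, z)\<in>J. x)" and "q = (\<lambda>(i, x, y, z)\<in>J. y)" and "r = (\<lambda>(i, x, y, z)\<in>J. z)"
  define T where "T = generated F B {p, q, r}"
  define \<theta> where "\<theta> = (\<lambda>K. {(g, h). g \<in> T \<and> h \<in> T \<and> (\<forall>k\<in>K. g k = h k)})"
  have B: "B \<in> variety F E"
    unfolding B_def by (rule variety_prod_alg[OF wf]) (use A in \<open>auto simp: J_def\<close>)
  then have algB: "algebra F B" by (simp add: variety_def)
  have pqr: "{p, q, r} \<subseteq> carrier B"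
    by (auto simp: B_def prod_alg_def p_def q_def r_def J_def)
  have T: "subalgebra F B T" unfolding T_def by (rule subalgebra_generated[OF algB pqr])
  have pqrT: "p \<in> T" "q \<in> T" "r \<in> T" unfolding T_def using generated_superset[of "{p, q, r}" F B] by auto
  have con: "congruence F (B\<lparr>carrier := T\<rparr>) (\<theta> K)" if K: "K \<subseteq> J" for K
    unfolding congruence_def
  proof (intro conjI allI impI)
    show "equiv (carrier (B\<lparr>carrier := T\<rparr>)) (\<theta> K)"
      by (rule equivI) (auto simp: \<theta>_def refl_on_def sym_def trans_def)
    fix f xs ys assume f: "(f, length xs) \<in> F" and l: "list_all2 (\<lambda>x y. (x, y) \<in> \<theta> K) xs ys"
    have len: "length ys = length xs" using list_all2_lengthD[OF l] by simp
    have nth: "(xs ! k, ys ! k) \<in> \<theta> K" if "k < length xs" for k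
      using list_all2_nthD[OF l that] .
    then have "set xs \<subseteq> T" "set ys \<subseteq> T" using len by (auto simp: in_set_conv_nth \<theta>_def)
    then have "oper B f xs \<in> T" "oper B f ys \<in> T" using T f len unfolding subalgebra_def by auto
    moreover have "map (\<lambda>x. x k) xs = map (\<lambda>x. x k) ys" if "k \<in> K" for k
      using nth len that by (auto simp: list_eq_iff_nth_eq \<theta>_def)
    then have "oper B f xs k = oper B f ys k" if "k \<in> K" for k
    proof -
      have "k \<in> J" using that K by blast
      then show ?thesis using \<open>\<And>k. k \<in> K \<Longrightarrow> map (\<lambda>x. x k) xs = map (\<lambda>x. x k) ys\<close>[OF that]
        by (simp only: B_def oper_prod_alg)
    qed
    ultimately show "(oper (B\<lparr>carrier := T\<rparr>) f xs, oper (B\<lparr>carrier := T\<rparr>) f ys) \<in> \<theta> K"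
      by (simp add: \<theta>_def)
  qed
  define K1 K2 where "K1 = {(i, x, y, z). (i, x, y, z) \<in> J \<and> x = y}"
    and "K2 = {(i, x, y, z). (i, x, y, z) \<in> J \<and> y = z}"
  have "K1 \<subseteq> J" "K2 \<subseteq> J" by (auto simp: K1_def K2_def)
  then have "\<theta> K1 O \<theta> K2 = \<theta> K2 O \<theta> K1"
    by (intro congruence_permutable_any_type[OF wf cp variety_subalgebra[OF B T]] con)
  moreover have "(p, q) \<in> \<theta> K1" "(q, r) \<in> \<theta> K2"
    using pqrT by (auto simp: \<theta>_def K1_def K2_def p_def q_def r_def)
  ultimately have "(p, r) \<in> \<theta> K2 O \<theta> K1" by blast
  then obtain h where h: "(p, h) \<in> \<theta> K2" "(h, r) \<in> \<theta> K1" by blast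
  \<comment> \<open>Outside the carriers \<open>m\<close> is chosen such that the Mal'cev laws hold for all values, so that
    later computations need no membership conditions.\<close>
  define m where "m = (\<lambda>i x y z. if (i, x, y, z) \<in> J then h (i, x, y, z) else if x = y then z else x)"
  show thesis
  proof
    show "m i x x y = y" for i x y
      using h(2) by (auto simp: m_def \<theta>_def K1_def r_def)
    show "m i x y y = x" for i x y
      using h(1) by (auto simp: m_def \<theta>_def K2_def p_def)
    fix S u v w assume S: "subalgebra F (prod_alg I A) S" and uvw: "u \<in> S" "v \<in> S" "w \<in> S"
    have inJ: "(i, u i, v i, w i) \<in> J" if "i \<in> I" for i
      using that uvw S by (auto simp: J_def subalgebra_def prod_alg_def)
    have uvwI: "(\<lambda>i\<in>I. u i) = u" "(\<lambda>i\<in>I. v i) = v" "(\<lambda>i\<in>I. w i) = w"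
      using uvw S by (auto simp: subalgebra_def prod_alg_def PiE_def intro!: extensional_restrict)
    \<comment> \<open>The operations that send \<open>u, v, w\<close> into \<open>S\<close> form a subalgebra containing the projections.\<close>
    define T' where "T' = {g \<in> carrier B. (\<lambda>i\<in>I. g (i, u i, v i, w i)) \<in> S}"
    have "subalgebra F B T'"
      unfolding subalgebra_def
    proof (intro conjI allI impI)
      fix f gs assume f: "(f, length gs) \<in> F" and gs: "set gs \<subseteq> T'"
      have "oper B f gs \<in> carrier B"
        using f gs algB unfolding T'_def algebra_def subalgebra_def by blast
      moreover have "set (map (\<lambda>g. \<lambda>i\<in>I. g (i, u i, v i, w i)) gs) \<subseteq> S" using gs by (auto simp: T'_def)
      then have "oper (prod_alg I A) f (map (\<lambda>g. \<lambda>i\<in>I. g (i, u i, v i, w i)) gs) \<in> S"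
        using f by (intro subalgebra_oper[OF S]) simp_all
      moreover have "oper (prod_alg I A) f (map (\<lambda>g. \<lambda>i\<in>I. g (i, u i, v i, w i)) gs)
          = (\<lambda>i\<in>I. oper B f gs (i, u i, v i, w i))"
        using inJ by (auto simp: prod_alg_def B_def fun_eq_iff o_def)
      ultimately show "oper B f gs \<in> T'" by (simp add: T'_def)
    qed (auto simp: T'_def)
    moreover have "{p, q, r} \<subseteq> T'"
      using pqr uvw inJ uvwI by (auto simp: T'_def p_def q_def r_def cong: restrict_cong)
    ultimately have "T \<subseteq> T'" unfolding T_def by (intro generated_least)
    moreover have "h \<in> T" using h by (auto simp: \<theta>_def)
    ultimately have "(\<lambda>i\<in>I. h (i, u i, v i, w i)) \<in> S" by (auto simp: T'_def)
    then show "(\<lambda>i\<in>I. m i (u i) (v i) (w i)) \<in> S"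
      using inJ by (simp add: m_def cong: restrict_cong)
  qed
qed

section \<open>Completing a cube by a Mal'cev operation\<close>

text \<open>
  For a cube \<open>g\<close> of dimension \<open>k + 1\<close>, \<open>fill m k g\<close> is computed from the values of \<open>g\<close> away from
  the corner \<open>(1,\<dots>,1)\<close>.  For the square it is \<open>m(g(1,0), g(0,0), g(0,1))\<close>, the fourth vertex of a
  parallelogram; in general \<open>m\<close> corrects \<open>g(1,\<dots>,1,0)\<close> by the difference between the values
  computed for the two faces orthogonal to the last direction.
\<close>

fun fill :: "('a \<Rightarrow> 'a \<Rightarrow> 'a \<Rightarrow> 'a) \<Rightarrow> nat \<Rightarrow> (bool list \<Rightarrow> 'a) \<Rightarrow> 'a" where
  "fill m 0 g = g [False]"
| "fill m (Suc k) g = m (g (replicate (Suc k) True @ [False]))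
     (fill m k (\<lambda>x. g (x @ [False]))) (fill m k (\<lambda>x. g (x @ [True])))"

lemma replicate_Suc_snoc: "replicate (Suc k) x = replicate k x @ [x]"
  by (simp add: replicate_append_same)

lemma fill_cong:
  assumes "\<And>x. length x = Suc k \<Longrightarrow> x \<noteq> replicate (Suc k) True \<Longrightarrow> g x = h x"
  shows "fill m k g = fill m k h"
  using assms
proof (induction k arbitrary: g h)
  case 0
  then show ?case by simp
next
  case (Suc k)
  have "fill m k (\<lambda>x. g (x @ [b])) = fill m k (\<lambda>x. h (x @ [b]))" for b
    by (rule Suc.IH, rule Suc.prems) (simp_all only: replicate_Suc_snoc append1_eq_conv length_append_singleton, auto)
  moreover have "g (replicate (Suc k) True @ [False]) = h (replicate (Suc k) True @ [False])"
    by (rule Suc.prems) (simp_all only: replicate_Suc_snoc[of "Suc k"] append1_eq_conv length_append_singleton, auto)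
  ultimately show ?case by simp
qed

text \<open>
  If the direction \<open>p\<close> is the last one, then the two faces are equal and their contributions cancel;
  otherwise both faces are constant in direction \<open>p\<close>, so by induction the first one is filled with
  \<open>g(1,\<dots>,1,0)\<close>, which cancels against the leading argument of \<open>m\<close>, and the second one with the actual corner.
\<close>

lemma fill_independent:
  assumes left: "\<And>x y. m x x y = y" and right: "\<And>x y. m x y y = x"
    and p: "p \<le> k" and g: "\<And>x b. length x = Suc k \<Longrightarrow> g (x[p := b]) = g x"
  shows "fill m k g = g (replicate (Suc k) True)"
  using p g
proof (induction k arbitrary: g p)
  case 0
  then show ?case using "0.prems"(2)[of "[True]" False] by simp
next
  case (Suc k)
  let ?one = "replicate (Suc k) True"
  show ?case
  proof (cases "p = Suc k")
    case True
    have flip: "g (x @ [False]) = g (x @ [True])" if "length x = Suc k" for x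
      using Suc.prems(2)[of "x @ [True]" False] that True by (simp add: list_update_append)
    then have "fill m k (\<lambda>x. g (x @ [False])) = fill m k (\<lambda>x. g (x @ [True]))"
      by (intro fill_cong)
    then have "fill m (Suc k) g = g (?one @ [False])" using right by (simp only: fill.simps)
    then show ?thesis using flip[of ?one] by (simp only: replicate_Suc_snoc[of "Suc k"] length_replicate)
  next
    case False
    then have p: "p \<le> k" using Suc.prems by simp
    have IH: "fill m k (\<lambda>x. g (x @ [c])) = g (?one @ [c])" for c
    proof (rule Suc.IH[OF p])
      fix x :: "bool list" and b assume x: "length x = Suc k"
      then have "x[p := b] @ [c] = (x @ [c])[p := b]" using p by (simp add: list_update_append)
      then show "g (x[p := b] @ [c]) = g (x @ [c])" using Suc.prems(2)[of "x @ [c]" b] x by simp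
    qed
    have "fill m (Suc k) g = g (?one @ [True])" using left by (simp only: fill.simps IH)
    then show ?thesis by (simp only: replicate_Suc_snoc[of "Suc k"])
  qed
qed

text \<open>
  Here the two faces agree except at the corner that is not used to fill them, so their
  contributions cancel.
\<close>

lemma fill_last:
  assumes right: "\<And>x y. m x y y = x"
    and g: "\<And>x. length x = k \<Longrightarrow> x \<noteq> replicate k True \<Longrightarrow> g (x @ [False]) = g (x @ [True])"
  shows "fill m k g = g (replicate k True @ [False])"
proof (cases k)
  case 0
  then show ?thesis by simp
next
  case (Suc k')
  have "fill m k' (\<lambda>x. g (x @ [False])) = fill m k' (\<lambda>x. g (x @ [True]))"
    by (rule fill_cong) (use g Suc in blast)
  then show ?thesis using right Suc by (simp only: fill.simps)
qed

section \<open>Subdirect products closed under Mal'cev operations\<close>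

text \<open>
  The operations \<open>m i\<close> are fixed independently of \<open>C\<close>, so that two subdirect products of the same
  factors can be compared.
\<close>

locale malcev_subdirect =
  fixes F :: "('f \<times> nat) set" and I :: "'i set" and A :: "'i \<Rightarrow> ('f, 'a) alg"
    and C :: "('i \<Rightarrow> 'a) set" and m :: "'i \<Rightarrow> 'a \<Rightarrow> 'a \<Rightarrow> 'a \<Rightarrow> 'a"
  assumes algebras: "i \<in> I \<Longrightarrow> algebra F (A i)"
    and subdirect: "subdirect F I A C"
    and left: "m i x x y = y" and right: "m i x y y = x"
    and closed: "u \<in> C \<Longrightarrow> v \<in> C \<Longrightarrow> w \<in> C \<Longrightarrow> (\<lambda>i\<in>I. m i (u i) (v i) (w i)) \<in> C"
begin

definition M :: "('i \<Rightarrow> 'a) \<Rightarrow> ('i \<Rightarrow> 'a) \<Rightarrow> ('i \<Rightarrow> 'a) \<Rightarrow> 'i \<Rightarrow> 'a" where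
  "M u v w = (\<lambda>i\<in>I. m i (u i) (v i) (w i))"

lemma M_apply [simp]: "i \<in> I \<Longrightarrow> M u v w i = m i (u i) (v i) (w i)"
  by (simp add: M_def)

lemma M_closed: "u \<in> C \<Longrightarrow> v \<in> C \<Longrightarrow> w \<in> C \<Longrightarrow> M u v w \<in> C"
  unfolding M_def by (rule closed)

lemma sub_C: "C \<subseteq> carrier (prod_alg I A)"
  and oper_C: "(f, length xs) \<in> F \<Longrightarrow> set xs \<subseteq> C \<Longrightarrow> oper (prod_alg I A) f xs \<in> C"
  and proj_C: "i \<in> I \<Longrightarrow> (\<lambda>c. c i) ` C = carrier (A i)"
  using subdirect unfolding subdirect_def subalgebra_def by blast+

text \<open>
  For \<open>J = {i}\<close> this is \<open>\<lambda>\<^sub>i\<^sub>j\<close>, and for the complement of \<open>j\<close> it consists of the changes of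
  the \<open>j\<close>-th coordinate that some element of \<open>C\<close> admits.
\<close>

definition agree :: "'i set \<Rightarrow> 'i \<Rightarrow> 'a rel" where
  "agree J j = {(c j, d j) | c d. c \<in> C \<and> d \<in> C \<and> (\<forall>i\<in>J. c i = d i)}"

text \<open>
  Transitivity comes from \<open>m\<close>: if \<open>u, v\<close> agree on \<open>J\<close>, \<open>v', w\<close> agree on \<open>J\<close> and \<open>v\<^sub>j = v'\<^sub>j\<close>, then
  \<open>m(u, v, v')\<close> has the \<open>j\<close>-th coordinate of \<open>u\<close> and agrees with \<open>v'\<close>, hence with \<open>w\<close>, on \<open>J\<close>.
\<close>

lemma congruence_agree:
  assumes j: "j \<in> I" and J: "J \<subseteq> I"
  shows "congruence F (A j) (agree J j)"
  unfolding congruence_def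
proof (intro conjI allI impI)
  show "equiv (carrier (A j)) (agree J j)"
  proof (rule equivI)
    show "agree J j \<subseteq> carrier (A j) \<times> carrier (A j)"
      using proj_C[OF j] unfolding agree_def by blast
    show "refl_on (carrier (A j)) (agree J j)"
      unfolding agree_def proj_C[OF j, symmetric] by (rule refl_onI) blast
    show "sym (agree J j)"
      unfolding agree_def sym_def by (clarsimp, metis)
    show "trans (agree J j)"
    proof (rule transI)
      fix x y z assume "(x, y) \<in> agree J j" "(y, z) \<in> agree J j"
      then obtain u v v' w where *: "u \<in> C" "v \<in> C" "v' \<in> C" "w \<in> C" "x = u j" "y = v j" "y = v' j" "z = w j"
        "\<forall>i\<in>J. u i = v i" "\<forall>i\<in>J. v' i = w i" unfolding agree_def by blast
      have "M u v v' j = x" using * j right by simp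
      moreover have "\<forall>i\<in>J. M u v v' i = w i" using * J left by (auto simp: subset_iff)
      ultimately show "(x, z) \<in> agree J j" using * M_closed[of u v v'] unfolding agree_def by blast
    qed
  qed
  fix f xs ys assume f: "(f, length xs) \<in> F" and l: "list_all2 (\<lambda>x y. (x, y) \<in> agree J j) xs ys"
  have len: "length ys = length xs" using list_all2_lengthD[OF l] by simp
  \<comment> \<open>Witnesses are chosen for all pairs of arguments at once, and the operation is applied to them.\<close>
  have "\<forall>k<length xs. \<exists>p. fst p \<in> C \<and> snd p \<in> C \<and> xs ! k = fst p j \<and> ys ! k = snd p j \<and>
      (\<forall>i\<in>J. fst p i = snd p i)"
  proof (intro allI impI)
    fix k assume "k < length xs"
    then have "(xs ! k, ys ! k) \<in> agree J j" by (rule list_all2_nthD[OF l])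
    then obtain c d where "c \<in> C" "d \<in> C" "xs ! k = c j" "ys ! k = d j" "\<forall>i\<in>J. c i = d i"
      unfolding agree_def by blast
    then show "\<exists>p. fst p \<in> C \<and> snd p \<in> C \<and> xs ! k = fst p j \<and> ys ! k = snd p j \<and>
      (\<forall>i\<in>J. fst p i = snd p i)"
      by (intro exI[of _ "(c, d)"]) simp
  qed
  then obtain ps where ps: "length ps = length xs" and nth: "\<And>k. k < length xs \<Longrightarrow>
     fst (ps ! k) \<in> C \<and> snd (ps ! k) \<in> C \<and> xs ! k = fst (ps ! k) j \<and> ys ! k = snd (ps ! k) j \<and>
     (\<forall>i\<in>J. fst (ps ! k) i = snd (ps ! k) i)"
    unfolding Skolem_list_nth by blast
  define c d where "c = oper (prod_alg I A) f (map fst ps)" and "d = oper (prod_alg I A) f (map snd ps)"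
  have "p \<in> set ps \<Longrightarrow> fst p \<in> C \<and> snd p \<in> C" for p
    using nth ps by (metis in_set_conv_nth)
  then have "set (map fst ps) \<subseteq> C" "set (map snd ps) \<subseteq> C" by auto
  then have "c \<in> C" "d \<in> C" using f ps unfolding c_def d_def by (simp_all add: oper_C)
  moreover have "map (\<lambda>x. x j) (map fst ps) = xs" "map (\<lambda>x. x j) (map snd ps) = ys"
    using nth ps len by (auto simp: list_eq_iff_nth_eq)
  then have "c j = oper (A j) f xs" "d j = oper (A j) f ys"
    using j by (auto simp: c_def d_def oper_prod_alg simp del: map_map)
  moreover have "c i = d i" if "i \<in> J" for i
  proof -
    have "map (\<lambda>x. x i) (map fst ps) = map (\<lambda>x. x i) (map snd ps)"
      using nth ps that by (auto simp: list_eq_iff_nth_eq)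
    moreover have "i \<in> I" using that J by blast
    ultimately show ?thesis by (simp only: c_def d_def oper_prod_alg)
  qed
  ultimately show "(oper (A j) f xs, oper (A j) f ys) \<in> agree J j" unfolding agree_def
    by (intro CollectI exI[of _ c] exI[of _ d]) simp
qed

text \<open>
  The relational product of the kernels is a congruence.  For \<open>c\<^sub>i = e\<^sub>i\<close> and \<open>e\<^sub>j = d\<^sub>j\<close> the
  element \<open>m(c, e, d)\<close> witnesses symmetry; transitivity is witnessed by \<open>m(e, d, e')\<close>, where \<open>e\<close>
  and \<open>e'\<close> witness the two given pairs and \<open>d\<close> is their middle element.
\<close>

lemma con_join_ker_proj:
  assumes i: "i \<in> I" and j: "j \<in> I"
  shows "con_join F (prod_alg I A\<lparr>carrier := C\<rparr>) (ker_proj C i) (ker_proj C j)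
    = ker_proj C i O ker_proj C j" (is "con_join F ?C _ _ = ?\<theta>")
  unfolding con_join_def
proof (rule hull_unique)
  show "ker_proj C i \<union> ker_proj C j \<subseteq> ?\<theta>" unfolding ker_proj_def by blast
  show "congruence F ?C ?\<theta>"
    unfolding congruence_def
  proof (intro conjI allI impI)
    have "sym ?\<theta>"
    proof (rule symI)
      fix c d assume "(c, d) \<in> ?\<theta>"
      then obtain e where *: "c \<in> C" "e \<in> C" "d \<in> C" "c i = e i" "e j = d j" unfolding ker_proj_def by blast
      then have "M c e d i = d i" "M c e d j = c j" using i j left right by auto
      then show "(d, c) \<in> ?\<theta>" using * M_closed[of c e d] unfolding ker_proj_def by fastforce
    qed
    moreover have "trans ?\<theta>"
    proof (rule transI)
      fix c d g assume "(c, d) \<in> ?\<theta>" "(d, g) \<in> ?\<theta>"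
      then obtain e e' where *: "c \<in> C" "e \<in> C" "d \<in> C" "e' \<in> C" "g \<in> C"
        "c i = e i" "e j = d j" "d i = e' i" "e' j = g j" unfolding ker_proj_def by blast
      then have "M e d e' i = c i" "M e d e' j = g j" using i j left right by auto
      then show "(c, g) \<in> ?\<theta>" using * M_closed[of e d e'] unfolding ker_proj_def by fastforce
    qed
    ultimately show "equiv (carrier ?C) ?\<theta>"
      unfolding equiv_def by (auto simp: refl_on_def ker_proj_def)
    fix f xs ys assume f: "(f, length xs) \<in> F" and l: "list_all2 (\<lambda>x y. (x, y) \<in> ?\<theta>) xs ys"
    have len: "length ys = length xs" using list_all2_lengthD[OF l] by simp
    have "\<forall>k<length xs. \<exists>e. (xs ! k, e) \<in> ker_proj C i \<and> (e, ys ! k) \<in> ker_proj C j"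
      using list_all2_nthD[OF l] by blast
    then obtain es where es: "length es = length xs" and nth: "\<And>k. k < length xs \<Longrightarrow>
       (xs ! k, es ! k) \<in> ker_proj C i \<and> (es ! k, ys ! k) \<in> ker_proj C j"
      unfolding Skolem_list_nth by blast
    have "set xs \<subseteq> C" "set es \<subseteq> C" "set ys \<subseteq> C"
      using nth es len by (auto simp: in_set_conv_nth ker_proj_def)
    then have "oper (prod_alg I A) f xs \<in> C" "oper (prod_alg I A) f es \<in> C" "oper (prod_alg I A) f ys \<in> C"
      using f es len oper_C by auto
    moreover have "map (\<lambda>x. x i) xs = map (\<lambda>x. x i) es" "map (\<lambda>x. x j) es = map (\<lambda>x. x j) ys"
      using nth es len by (auto simp: list_eq_iff_nth_eq ker_proj_def)
    ultimately show "(oper ?C f xs, oper ?C f ys) \<in> ?\<theta>"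
      using i j by (auto simp: ker_proj_def oper_prod_alg intro!: relcompI[of _ "oper (prod_alg I A) f es"])
  qed
  fix \<theta> assume "ker_proj C i \<union> ker_proj C j \<subseteq> \<theta>" "congruence F ?C \<theta>"
  then show "?\<theta> \<subseteq> \<theta>" unfolding congruence_def equiv_def trans_def by blast
qed

lemma proj_con_join:
  assumes i: "i \<in> I" and j: "j \<in> I"
  shows "(\<lambda>(c, d). (c j, d j)) ` con_join F (prod_alg I A\<lparr>carrier := C\<rparr>) (ker_proj C i) (ker_proj C j)
    = agree {i} j"
  unfolding con_join_ker_proj[OF assms]
proof
  show "(\<lambda>(c, d). (c j, d j)) ` (ker_proj C i O ker_proj C j) \<subseteq> agree {i} j"
    by (auto simp: agree_def ker_proj_def) metis
  show "agree {i} j \<subseteq> (\<lambda>(c, d). (c j, d j)) ` (ker_proj C i O ker_proj C j)"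
  proof
    fix p assume "p \<in> agree {i} j"
    then obtain c d where p: "p = (c j, d j)" and "c \<in> C" "d \<in> C" "c i = d i"
      unfolding agree_def by blast
    then have "(c, d) \<in> ker_proj C i O ker_proj C j" unfolding ker_proj_def by blast
    then show "p \<in> (\<lambda>(c, d). (c j, d j)) ` (ker_proj C i O ker_proj C j)"
      unfolding p by force
  qed
qed

lemma fill_closed:
  assumes "\<And>x. length x = Suc k \<Longrightarrow> G x \<in> C"
  shows "fill M k G \<in> C"
  using assms
proof (induction k arbitrary: G)
  case (Suc k)
  have "fill M k (\<lambda>x. G (x @ [b])) \<in> C" for b
    by (rule Suc.IH) (simp add: Suc.prems)
  moreover have "G (replicate (Suc k) True @ [False]) \<in> C"
    by (rule Suc.prems) simp
  ultimately show ?case by (simp only: fill.simps M_closed)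
qed simp

lemma fill_apply: "i \<in> I \<Longrightarrow> fill M k G i = fill (m i) k (\<lambda>x. G x i)"
  by (induction k arbitrary: G) auto

text \<open>
  A generator \<open>cube (a, b)\<close> in direction \<open>p\<close>, where \<open>a = c\<^sub>j\<close>, \<open>b = d\<^sub>j\<close> and \<open>c, d \<in> C\<close> agree at
  \<open>js ! p\<close>, lifts to the cube of \<open>(c, d)\<close>.  The lifts of cubes are preserved by the operations of
  \<open>C\<close>, so that all elements generated have lifts.
\<close>

lemma cube_lift:
  assumes j: "j \<in> I" and js: "set js \<subseteq> I" and f: "f \<in> cube_alg F (A j) (map (\<lambda>i. agree {i} j) js)"
  obtains G where "\<And>x. length x = length js \<Longrightarrow> G x \<in> C \<and> G x j = f x"
    "\<And>p x b. p < length js \<Longrightarrow> length x = length js \<Longrightarrow> G (x[p := b]) (js ! p) = G x (js ! p)"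
proof -
  let ?k = "length js"
  let ?X = "{x :: bool list. length x = ?k}"
  let ?P = "prod_alg ?X (\<lambda>_. A j)"
  define lift where "lift = (\<lambda>f G. (\<forall>x\<in>?X. G x \<in> C \<and> G x j = f x) \<and>
    (\<forall>p<?k. \<forall>x\<in>?X. \<forall>b. G (x[p := b]) (js ! p) = G x (js ! p)))"
  define S where "S = {f \<in> carrier ?P. \<exists>G. lift f G}"
  have algP: "algebra F ?P" using algebras[OF j] by (rule algebra_prod_alg)
  have "subalgebra F ?P S"
    unfolding subalgebra_def
  proof (intro conjI allI impI)
    fix g fs assume g: "(g, length fs) \<in> F" and fs: "set fs \<subseteq> S"
    have "\<forall>l<length fs. \<exists>G. lift (fs ! l) G"
    proof (intro allI impI)
      fix l assume "l < length fs"
      then have "fs ! l \<in> S" using fs nth_mem by blast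
      then show "\<exists>G. lift (fs ! l) G" by (simp add: S_def)
    qed
    then obtain Gs where Gs: "length Gs = length fs" and nth: "\<And>l. l < length fs \<Longrightarrow> lift (fs ! l) (Gs ! l)"
      unfolding Skolem_list_nth by blast
    define G where "G = (\<lambda>x. oper (prod_alg I A) g (map (\<lambda>H. H x) Gs))"
    have "lift (oper ?P g fs) G"
      unfolding lift_def
    proof (intro conjI ballI allI impI)
      fix x assume x: "x \<in> ?X"
      have "set (map (\<lambda>H. H x) Gs) \<subseteq> C" using nth Gs x by (auto simp: in_set_conv_nth lift_def)
      then show "G x \<in> C" using g Gs unfolding G_def by (intro oper_C) simp_all
      have "map (\<lambda>c. c j) (map (\<lambda>H. H x) Gs) = map (\<lambda>h. h x) fs"
        using nth Gs x by (auto simp: list_eq_iff_nth_eq lift_def)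
      then show "G x j = oper ?P g fs x"
        using j x by (simp only: G_def oper_prod_alg)
      fix p b assume p: "p < ?k"
      have "map (\<lambda>c. c (js ! p)) (map (\<lambda>H. H (x[p := b])) Gs) = map (\<lambda>c. c (js ! p)) (map (\<lambda>H. H x) Gs)"
        using nth Gs x p by (auto simp: list_eq_iff_nth_eq lift_def)
      moreover have "js ! p \<in> I" using p js by auto
      ultimately show "G (x[p := b]) (js ! p) = G x (js ! p)"
        by (simp only: G_def oper_prod_alg)
    qed
    moreover have "oper ?P g fs \<in> carrier ?P"
      using algP g fs unfolding algebra_def subalgebra_def S_def by blast
    ultimately show "oper ?P g fs \<in> S" by (auto simp: S_def)
  qed (auto simp: S_def)
  moreover have "cube ?k p a b \<in> S" if p: "p < ?k" and ab: "(a, b) \<in> agree {js ! p} j" for p a b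
  proof -
    obtain c d where *: "c \<in> C" "d \<in> C" "a = c j" "b = d j" "c (js ! p) = d (js ! p)"
      using ab unfolding agree_def by blast
    have "a \<in> carrier (A j)" "b \<in> carrier (A j)" using * proj_C[OF j] by auto
    then have "cube ?k p a b \<in> carrier ?P" by (auto simp: cube_def prod_alg_def)
    moreover have "lift (cube ?k p a b) (cube ?k p c d)"
      unfolding lift_def
    proof (intro conjI ballI allI impI)
      fix q and x :: "bool list" and b' assume q: "q < ?k" and x: "x \<in> ?X"
      show "cube ?k p c d (x[q := b']) (js ! q) = cube ?k p c d x (js ! q)"
        using x q *(5) by (cases "q = p") (auto simp: cube_def)
    qed (use * in \<open>auto simp: cube_def\<close>)
    ultimately show ?thesis by (auto simp: S_def)
  qed
  ultimately have "cube_alg F (A j) (map (\<lambda>i. agree {i} j) js) \<subseteq> S"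
    unfolding cube_alg_def length_map by (intro generated_least) auto
  then obtain G where "lift f G" using f by (auto simp: S_def)
  then show thesis by (intro that[of G]) (auto simp: lift_def)
qed

lemma replace_coordinate:
  assumes j: "j \<in> I" and c: "c \<in> C" and b: "(c j, b) \<in> agree (I - {j}) j"
  shows "c(j := b) \<in> C"
proof -
  obtain u v where *: "u \<in> C" "v \<in> C" "c j = u j" "b = v j" "\<forall>i\<in>I - {j}. u i = v i"
    using b unfolding agree_def by blast
  have "c \<in> extensional I" using c sub_C by (auto simp: prod_alg_def PiE_def)
  then have "M c u v = c(j := b)"
    using * j left right by (auto simp: fun_eq_iff M_def extensional_def)
  then show ?thesis using M_closed[of c u v] c * by simp
qed

text \<open>
  The higher-dimensional term condition: the corner obtained by filling the lifted cube and the
  actual corner differ only at \<open>j\<close>.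
\<close>

lemma agree_centralizes:
  assumes j: "j \<in> I" and js: "set js = I - {j}" "js \<noteq> []"
  shows "centralizes F (A j) (map (\<lambda>i. agree {i} j) js) (agree (I - {j}) j)"
  unfolding centralizes_def Let_def
proof (intro ballI impI)
  let ?\<eta> = "agree (I - {j}) j"
  fix f assume f: "f \<in> cube_alg F (A j) (map (\<lambda>i. agree {i} j) js)"
  obtain k where k: "length js = Suc k" using js(2) by (cases js) auto
  then have k': "length (map (\<lambda>i. agree {i} j) js) - 1 = k" by simp
  let ?one = "replicate k True"
  assume "\<forall>x. length x = length (map (\<lambda>i. agree {i} j) js) - 1 \<longrightarrow>
    x \<noteq> replicate (length (map (\<lambda>i. agree {i} j) js) - 1) True \<longrightarrow> (f (x @ [False]), f (x @ [True])) \<in> ?\<eta>"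
  then have \<eta>: "(f (x @ [False]), f (x @ [True])) \<in> ?\<eta>" if "length x = k" "x \<noteq> ?one" for x
    using that unfolding k' by blast
  obtain G where G: "\<And>x. length x = Suc k \<Longrightarrow> G x \<in> C \<and> G x j = f x"
    and indep: "\<And>p x b. p < Suc k \<Longrightarrow> length x = Suc k \<Longrightarrow> G (x[p := b]) (js ! p) = G x (js ! p)"
    by (rule cube_lift[OF j _ f]) (use js k in auto)
  \<comment> \<open>\<open>H\<close> is \<open>G\<close> with the \<open>j\<close>-th coordinates at \<open>(x, 1)\<close>, \<open>x \<noteq> (1,\<dots>,1)\<close>, moved along \<open>\<eta>\<close> to
    those at \<open>(x, 0)\<close>; filling it gives the element to be compared with \<open>G(1,\<dots>,1)\<close>.\<close>
  define H where "H = (\<lambda>x. if last x \<and> butlast x \<noteq> ?one then (G x)(j := f (butlast x @ [False])) else G x)"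
  have sym: "sym ?\<eta>" using congruence_agree[OF j, of "I - {j}"] unfolding congruence_def equiv_def by auto
  have "H x \<in> C" if x: "length x = Suc k" for x
  proof (cases "last x \<and> butlast x \<noteq> ?one")
    case True
    have "x \<noteq> []" using x by auto
    then have xb: "x = butlast x @ [True]" using append_butlast_last_id[of x] True by simp
    have "(f (butlast x @ [False]), f x) \<in> ?\<eta>"
      using \<eta>[of "butlast x"] True x by (subst (2) xb) simp
    then have "(G x j, f (butlast x @ [False])) \<in> ?\<eta>" using G[OF x] sym by (auto dest: symD)
    then have "(G x)(j := f (butlast x @ [False])) \<in> C" using replace_coordinate[OF j] G[OF x] by blast
    then show ?thesis using True by (simp add: H_def)
  qed (use G[OF x] in \<open>auto simp: H_def\<close>)
  then have "fill M k H \<in> C" by (rule fill_closed)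
  moreover have "G (replicate (Suc k) True) \<in> C" using G by simp
  moreover have "fill M k H i = G (replicate (Suc k) True) i" if i: "i \<in> I - {j}" for i
  proof -
    obtain p where p: "p < Suc k" "js ! p = i" using i js(1) k by (metis in_set_conv_nth)
    have "H x i = G x i" for x using i by (simp add: H_def)
    then have "fill M k H i = fill (m i) k (\<lambda>x. G x i)" using i by (simp add: fill_apply)
    also have "\<dots> = G (replicate (Suc k) True) i"
      by (rule fill_independent[where p = p]) (use p indep left right in auto)
    finally show ?thesis .
  qed
  moreover have "fill M k H j = f (?one @ [False])"
  proof -
    have "fill M k H j = fill (m j) k (\<lambda>x. H x j)" using j by (simp add: fill_apply)
    also have "\<dots> = H (?one @ [False]) j"
      by (rule fill_last) (use G right in \<open>auto simp: H_def\<close>)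
    also have "\<dots> = f (?one @ [False])" using G by (simp add: H_def)
    finally show ?thesis .
  qed
  moreover have "G (replicate (Suc k) True) j = f (?one @ [True])"
    using G[of "replicate (Suc k) True"] by (simp only: replicate_Suc_snoc length_append_singleton length_replicate)
  ultimately have "(f (?one @ [False]), f (?one @ [True])) \<in> ?\<eta>" unfolding agree_def by (smt (verit) mem_Collect_eq)
  then show "(f (replicate (length (map (\<lambda>i. agree {i} j) js) - 1) True @ [False]),
    f (replicate (length (map (\<lambda>i. agree {i} j) js) - 1) True @ [True])) \<in> ?\<eta>"
    unfolding k' .
qed

lemma commutator_agree:
  assumes j: "j \<in> I" and js: "set js = I - {j}" "js \<noteq> []"
  shows "congruence F (A j) (commutator F (A j) (map (\<lambda>i. agree {i} j) js))"
    "commutator F (A j) (map (\<lambda>i. agree {i} j) js) \<subseteq> agree (I - {j}) j"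
proof -
  have con: "\<alpha> \<in> set (map (\<lambda>i. agree {i} j) js) \<Longrightarrow> congruence F (A j) \<alpha>" for \<alpha>
    using congruence_agree[OF j] js(1) by auto
  show "congruence F (A j) (commutator F (A j) (map (\<lambda>i. agree {i} j) js))"
    by (rule commutator_least(1)[OF algebras[OF j] con]) (use js in auto)
  show "commutator F (A j) (map (\<lambda>i. agree {i} j) js) \<subseteq> agree (I - {j}) j"
    by (rule commutator_least(3)[OF algebras[OF j] con _ congruence_agree[OF j] agree_centralizes[OF assms]])
      (use js in auto)
qed

lemma saturated:
  assumes fin: "finite I" and \<gamma>: "\<And>j. j \<in> I \<Longrightarrow> \<gamma> j \<subseteq> agree (I - {j}) j"
    and c: "c \<in> C" and cd: "(c, d) \<in> prod_con I A \<gamma>"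
  shows "d \<in> C"
proof -
  have "(\<lambda>i. if i \<in> J then d i else c i) \<in> C" if "finite J" "J \<subseteq> I" for J
    using that
  proof (induction J)
    case empty
    then show ?case using c by simp
  next
    case (insert j J)
    let ?e = "\<lambda>i. if i \<in> J then d i else c i"
    have "(?e j, d j) \<in> agree (I - {j}) j" using insert \<gamma> cd by (auto simp: prod_con_def)
    then have "?e(j := d j) \<in> C" using insert by (intro replace_coordinate) auto
    moreover have "?e(j := d j) = (\<lambda>i. if i \<in> insert j J then d i else c i)" by auto
    ultimately show ?case by simp
  qed
  then have "(\<lambda>i. if i \<in> I then d i else c i) \<in> C" using fin by blast
  moreover have "c \<in> extensional I" "d \<in> extensional I"
    using cd by (auto simp: prod_con_def prod_alg_def PiE_def)
  then have "(\<lambda>i. if i \<in> I then d i else c i) = d" by (auto simp: fun_eq_iff extensional_def)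
  ultimately show ?thesis by simp
qed

end

section \<open>Recovering a subdirect product from quotients and projections\<close>

text \<open>
  With \<open>agree {i} j\<close> being \<open>\<lambda>\<^sub>i\<^sub>j\<close>, this is why the congruences in the theorem depend only on the
  projections to two coordinates.
\<close>

lemma agree_pr2:
  assumes "malcev_subdirect F I A C m" "malcev_subdirect F I A D m" and "pr2 i j ` D = pr2 i j ` C"
  shows "malcev_subdirect.agree D {i} j = malcev_subdirect.agree C {i} j"
proof -
  have sub: "malcev_subdirect.agree S {i} j \<subseteq> malcev_subdirect.agree S' {i} j"
    if S: "malcev_subdirect F I A S m" "malcev_subdirect F I A S' m" and pr: "pr2 i j ` S \<subseteq> pr2 i j ` S'" for S S'
  proof
    fix p assume "p \<in> malcev_subdirect.agree S {i} j"
    then obtain c d where p: "p = (c j, d j)" and *: "c \<in> S" "d \<in> S" "c i = d i"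
      unfolding malcev_subdirect.agree_def[OF S(1)] by blast
    obtain c' d' where **: "c' \<in> S'" "d' \<in> S'" "pr2 i j c = pr2 i j c'" "pr2 i j d = pr2 i j d'"
      using * pr by blast
    have "c' i = c i" "c' j = c j" "d' i = d i" "d' j = d j"
      using **(3,4) by (metis insertCI pr2_def restrict_apply')+
    then show "p \<in> malcev_subdirect.agree S' {i} j"
      using p *(3) **(1,2) unfolding malcev_subdirect.agree_def[OF S(2)]
      by (intro CollectI exI[of _ c'] exI[of _ d']) simp
  qed
  show ?thesis using sub[OF assms(1,2)] sub[OF assms(2,1)] assms(3) by blast
qed

lemma set_upt_omit: "j \<in> {1..n} \<Longrightarrow> set ([1..<j] @ [Suc j..<Suc n]) = {1..n} - {j}"
  by auto

text \<open>
  As \<open>n \<ge> 2\<close>, every coordinate occurs in some projection to two coordinates.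
\<close>

lemma subdirect_of_equal_projections:
  assumes n: "n \<ge> (2::nat)" and C: "subdirect F {1..n} A C" and D: "subalgebra F (prod_alg {1..n} A) D"
    and pr: "\<And>i j. i \<in> {1..n} \<Longrightarrow> j \<in> {1..n} \<Longrightarrow> i \<noteq> j \<Longrightarrow> pr2 i j ` D = pr2 i j ` C"
  shows "subdirect F {1..n} A D"
proof -
  have "(\<lambda>c. c i) ` D = carrier (A i)" if i: "i \<in> {1..n}" for i
  proof -
    obtain j where j: "j \<in> {1..n}" "i \<noteq> j"
      using n i that[of "if i = 1 then 2 else 1"] by auto
    have "(\<lambda>c. c i) ` S = (\<lambda>c. c i) ` pr2 i j ` S" for S :: "(nat \<Rightarrow> 'b) set"
      by (auto simp: pr2_def image_image)
    then have "(\<lambda>c. c i) ` D = (\<lambda>c. c i) ` C" using pr[OF i j] by metis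
    then show ?thesis using C i by (auto simp: subdirect_def)
  qed
  then show ?thesis using D by (auto simp: subdirect_def)
qed

theorem theorem4p1:
  fixes F :: "('f \<times> nat) set" and E :: "'f equations"
    and n :: nat and A :: "nat \<Rightarrow> ('f, 'a) alg" and C :: "(nat \<Rightarrow> 'a) set"
  assumes "n \<ge> 2"
    and "wf_equations F E"
    and "congruence_permutable F E"
    and "\<And>i. i \<in> {1..n} \<Longrightarrow> A i \<in> variety F E"
    and "subdirect F {1..n} A C"
  shows "(\<forall>i\<in>{1..n}. \<forall>j\<in>{1..n}. congruence F (A j) (lam F n A C i j)) \<and>
    (\<forall>j\<in>{1..n}. congruence F (A j) (gam F n A C j)) \<and>
    (\<exists>K \<subseteq> carrier (prod_alg {1..n} A) // prod_con {1..n} A (gam F n A C). C = \<Union>K) \<and>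
    (\<forall>D. subalgebra F (prod_alg {1..n} A) D \<and>
       (\<forall>i\<in>{1..n}. \<forall>j\<in>{1..n}. i < j \<longrightarrow> pr2 i j ` D = pr2 i j ` C) \<and>
       C // prod_con {1..n} A (gam F n A C) \<subseteq> D // prod_con {1..n} A (gam F n A C) \<longrightarrow>
       subalgebra F (prod_alg {1..n} A \<lparr>carrier := D\<rparr>) C) \<and>
    (finitely_generated F (prod_alg {1..n} A) C \<longleftrightarrow>
       finitely_generated F
         (quot_alg (prod_alg {1..n} A) (prod_con {1..n} A (gam F n A C)))
         (C // prod_con {1..n} A (gam F n A C)) \<and>
       (\<forall>i\<in>{1..n}. \<forall>j\<in>{1..n}. i < j \<longrightarrow>
          finitely_generated F (prod_alg {i, j} A) (pr2 i j ` C)))"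
proof -
  let ?I = "{1..n}" and ?P = "prod_alg {1..n} A" and ?\<gamma> = "gam F n A C"
  let ?R = "prod_con ?I A ?\<gamma>" and ?q = "\<lambda>c. prod_con {1..n} A (gam F n A C) `` {c}"
  obtain m :: "nat \<Rightarrow> 'a \<Rightarrow> 'a \<Rightarrow> 'a \<Rightarrow> 'a" where m: "\<And>i x y. m i x x y = y" "\<And>i x y. m i x y y = x"
    and m_closed: "\<And>S u v w. subalgebra F ?P S \<Longrightarrow> u \<in> S \<Longrightarrow> v \<in> S \<Longrightarrow> w \<in> S \<Longrightarrow>
       (\<lambda>i\<in>?I. m i (u i) (v i) (w i)) \<in> S"
    by (rule malcev_operations[OF assms(2,3), of ?I A]) (use assms(4) in blast)+
  have alg: "algebra F (A i)" if "i \<in> ?I" for i using assms(4)[OF that] by (simp add: variety_def)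
  have algP: "algebra F ?P" using alg by (rule algebra_prod_alg)
  have loc: "malcev_subdirect F ?I A S m" if S: "subdirect F ?I A S" for S
  proof
    show "subdirect F ?I A S" by (rule S)
    have "subalgebra F ?P S" using S by (simp add: subdirect_def)
    then show "(\<lambda>i\<in>?I. m i (u i) (v i) (w i)) \<in> S" if "u \<in> S" "v \<in> S" "w \<in> S" for u v w
      using m_closed that by blast
  qed (use alg m in auto)
  have lam: "lam F n A S i j = malcev_subdirect.agree S {i} j"
    if "subdirect F ?I A S" "i \<in> ?I" "j \<in> ?I" for S i j
    unfolding lam_def by (rule malcev_subdirect.proj_con_join[OF loc]) (use that in auto)
  have gam: "gam F n A S j = commutator F (A j)
      (map (\<lambda>i. malcev_subdirect.agree S {i} j) ([1..<j] @ [Suc j..<Suc n]))"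
    if S: "subdirect F ?I A S" and j: "j \<in> ?I" for S j
  proof -
    have "map (\<lambda>i. lam F n A S i j) ([1..<j] @ [Suc j..<Suc n])
        = map (\<lambda>i. malcev_subdirect.agree S {i} j) ([1..<j] @ [Suc j..<Suc n])"
      by (rule map_cong[OF refl], rule lam[OF S _ j]) (use set_upt_omit[OF j] in blast)
    then show ?thesis by (simp only: gam_def)
  qed
  have ne: "[1..<j] @ [Suc j..<Suc n] \<noteq> []" if "j \<in> ?I" for j using that assms(1) by auto
  have gam_con: "congruence F (A j) (gam F n A S j)" "gam F n A S j \<subseteq> malcev_subdirect.agree S (?I - {j}) j"
    if S: "subdirect F ?I A S" and j: "j \<in> ?I" for S j
    unfolding gam[OF S j]
    using malcev_subdirect.commutator_agree[OF loc[OF S] j set_upt_omit[OF j] ne[OF j]] by simp_all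
  have saturated: "d \<in> S" if S: "subdirect F ?I A S" and "c \<in> S" "(c, d) \<in> prod_con ?I A (gam F n A S)" for S c d
    using malcev_subdirect.saturated[OF loc[OF S] _ gam_con(2)[OF S]] that(2,3) by simp
  have subC: "subalgebra F ?P C" "C \<subseteq> carrier ?P" using assms(5) by (auto simp: subdirect_def subalgebra_def)
  have R: "congruence F ?P ?R" using alg gam_con(1)[OF assms(5)] by (rule congruence_prod_con)
  then have eqR: "equiv (carrier ?P) ?R" unfolding congruence_def by blast
  have quot: "S // ?R = ?q ` S" for S by (auto simp: quotient_def)

  have a: "\<exists>K \<subseteq> carrier ?P // ?R. C = \<Union>K"
  proof (intro exI conjI)
    show "C // ?R \<subseteq> carrier ?P // ?R" using subC by (auto simp: quotient_def)
    show "C = \<Union>(C // ?R)"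
      unfolding quot using saturated[OF assms(5)] subC equiv_class_self[OF eqR] by blast
  qed

  have b: "C \<subseteq> D" if D: "subalgebra F ?P D"
    and pr: "\<And>i j. i \<in> ?I \<Longrightarrow> j \<in> ?I \<Longrightarrow> i < j \<Longrightarrow> pr2 i j ` D = pr2 i j ` C"
    and q: "C // ?R \<subseteq> D // ?R" for D
  proof
    fix c assume c: "c \<in> C"
    have pr': "pr2 i j ` D = pr2 i j ` C" if "i \<in> ?I" "j \<in> ?I" "i \<noteq> j" for i j
      using pr[of i j] pr[of j i] that by (cases "i < j") (auto simp: pr2_def insert_commute)
    have sD: "subdirect F ?I A D" by (rule subdirect_of_equal_projections[OF assms(1,5) D pr'])
    have "gam F n A D j = ?\<gamma> j" if j: "j \<in> ?I" for j
    proof -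
      have "map (\<lambda>i. malcev_subdirect.agree D {i} j) ([1..<j] @ [Suc j..<Suc n])
        = map (\<lambda>i. malcev_subdirect.agree C {i} j) ([1..<j] @ [Suc j..<Suc n])"
        by (rule map_cong[OF refl], rule agree_pr2[OF loc[OF assms(5)] loc[OF sD] pr'])
          (use set_upt_omit[OF j] j in blast)+
      then show ?thesis by (simp only: gam[OF sD j] gam[OF assms(5) j])
    qed
    then have eq: "prod_con ?I A (gam F n A D) = ?R" by (auto simp: prod_con_def)
    obtain d where d: "d \<in> D" "?q c = ?q d" using q c unfolding quot by blast
    have "c \<in> ?q c" using equiv_class_self[OF eqR] c subC by blast
    then have "(d, c) \<in> ?R" using d(2) by blast
    then show "c \<in> D" using saturated[OF sD d(1)] eq by simp
  qed

  have fg1: "finitely_generated F (quot_alg ?P ?R) (C // ?R)" if "finitely_generated F ?P C"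
    unfolding quot
    by (rule finitely_generated_hom_image[OF algP algebra_quot_alg[OF algP R] hom_quotient[OF R] subC(2) that])
  have alg2: "algebra F (prod_alg {i, j} A)" if "i \<in> ?I" "j \<in> ?I" for i j
    by (rule algebra_prod_alg) (use alg that in blast)
  have fg2: "finitely_generated F (prod_alg {i, j} A) (pr2 i j ` C)"
    if "finitely_generated F ?P C" "i \<in> ?I" "j \<in> ?I" for i j
    by (rule finitely_generated_hom_image[OF algP alg2[OF that(2,3)] hom_pr2[OF that(2,3)] subC(2) that(1)])
  \<comment> \<open>Generators of an image of \<open>C\<close> can be chosen as images of elements of \<open>C\<close>.\<close>
  have lift: "\<exists>Y. finite Y \<and> Y \<subseteq> C \<and> generated F Q (h ` Y) = h ` C"
    if fg: "finitely_generated F Q (h ` C)" for Q :: "('f, 'q) alg" and h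
  proof -
    obtain X where X: "finite X" "X \<subseteq> h ` C" "generated F Q X = h ` C"
      using fg unfolding finitely_generated_def by blast
    obtain Y where "Y \<subseteq> C" "finite Y" "X = h ` Y" using finite_subset_image[OF X(1,2)] by blast
    then show ?thesis using X(3) by (intro exI[of _ Y]) simp
  qed
  have fg3: "finitely_generated F ?P C"
    if fq: "finitely_generated F (quot_alg ?P ?R) (C // ?R)"
      and fp: "\<And>i j. i \<in> ?I \<Longrightarrow> j \<in> ?I \<Longrightarrow> i < j \<Longrightarrow> finitely_generated F (prod_alg {i, j} A) (pr2 i j ` C)"
  proof -
    obtain Y0 where Y0: "finite Y0" "Y0 \<subseteq> C" "generated F (quot_alg ?P ?R) (?q ` Y0) = ?q ` C"
      using lift[OF fq[unfolded quot]] by blast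
    have "\<exists>Y. finite Y \<and> Y \<subseteq> C \<and> (i \<in> ?I \<longrightarrow> j \<in> ?I \<longrightarrow> i < j \<longrightarrow>
        generated F (prod_alg {i, j} A) (pr2 i j ` Y) = pr2 i j ` C)" for i j
    proof (cases "i \<in> ?I \<and> j \<in> ?I \<and> i < j")
      case True
      then show ?thesis using lift[OF fp[of i j]] by blast
    qed (rule exI[of _ "{}"], blast)
    then obtain Yp where Yp: "\<And>i j. finite (Yp i j)" "\<And>i j. Yp i j \<subseteq> C"
      "\<And>i j. i \<in> ?I \<Longrightarrow> j \<in> ?I \<Longrightarrow> i < j \<Longrightarrow>
        generated F (prod_alg {i, j} A) (pr2 i j ` Yp i j) = pr2 i j ` C"
      by metis
    define Y where "Y = Y0 \<union> (\<Union>i\<in>?I. \<Union>j\<in>?I. Yp i j)"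
    define D where "D = generated F ?P Y"
    have finY: "finite Y" using Y0(1) Yp(1) by (simp add: Y_def)
    have YC: "Y \<subseteq> C" unfolding Y_def by (intro Un_least UN_least Y0(2) Yp(2))
    have D: "subalgebra F ?P D" unfolding D_def using YC subC by (intro subalgebra_generated[OF algP]) auto
    have DC: "D \<subseteq> C" unfolding D_def by (rule generated_least[OF YC subC(1)])
    \<comment> \<open>\<open>D\<close> and \<open>C\<close> have the same image whenever \<open>Y\<close> contains preimages of generators of it.\<close>
    have img: "h ` D = h ` C"
      if "algebra F Q" "hom F ?P Q h" "Z \<subseteq> Y" "generated F Q (h ` Z) = h ` C"
      for Q :: "('f, 'q) alg" and h Z
    proof
      have "h ` C \<subseteq> generated F Q (h ` Y)"
        using hull_mono[OF image_mono[OF that(3)]] that(4) unfolding generated_def by metis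
      also have "\<dots> = h ` D"
        unfolding D_def using YC subC by (intro hom_image_generated[OF algP that(1,2), symmetric]) auto
      finally show "h ` C \<subseteq> h ` D" .
    qed (use DC in blast)
    have "pr2 i j ` D = pr2 i j ` C" if ij: "i \<in> ?I" "j \<in> ?I" "i < j" for i j
      by (rule img[OF alg2[OF ij(1,2)] hom_pr2[OF ij(1,2)] _ Yp(3)[OF ij]]) (use ij in \<open>auto simp: Y_def\<close>)
    moreover have "?q ` D = ?q ` C"
      by (rule img[OF algebra_quot_alg[OF algP R] hom_quotient[OF R] _ Y0(3)]) (simp add: Y_def)
    ultimately have "C \<subseteq> D" using b[OF D] unfolding quot by blast
    then show ?thesis
      using finY YC DC unfolding finitely_generated_def D_def by blast
  qed

  have "\<forall>i\<in>?I. \<forall>j\<in>?I. congruence F (A j) (lam F n A C i j)"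
    using lam[OF assms(5)] malcev_subdirect.congruence_agree[OF loc[OF assms(5)]] by simp
  moreover have "\<forall>j\<in>?I. congruence F (A j) (?\<gamma> j)"
    using gam_con(1)[OF assms(5)] by blast
  moreover have "subalgebra F (?P\<lparr>carrier := D\<rparr>) C"
    if "subalgebra F ?P D \<and> (\<forall>i\<in>?I. \<forall>j\<in>?I. i < j \<longrightarrow> pr2 i j ` D = pr2 i j ` C) \<and> C // ?R \<subseteq> D // ?R" for D
    using b[of D] that subC(1) unfolding subalgebra_def by simp
  moreover have "finitely_generated F ?P C \<longleftrightarrow> finitely_generated F (quot_alg ?P ?R) (C // ?R) \<and>
       (\<forall>i\<in>?I. \<forall>j\<in>?I. i < j \<longrightarrow> finitely_generated F (prod_alg {i, j} A) (pr2 i j ` C))"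
    using fg1 fg2 fg3 by blast
  ultimately show ?thesis using a by blast
qed

end
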